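(* Let $n\ge 2$, $\beta>0$, and let $S$ be a real symmetric $n\times n$ matrix with zero diagonal. There is an admissible threshold $\alpha_*>0$ (see context) such that for every constant $\alpha>\alpha_*$ the following holds for every $c\in\mathbb{R}$ and every orbit $x(t)$ in Hill's region $\mathcal{R}_c$ with Hamiltonian energy $c$: (1) if $x(t)$ is a transit orbit in $\mathcal{R}_c$, then $c\ge U_s$; (2) if $c<U_s$, then $x(t)$ is a capture orbit in $\mathcal{R}_c$.
   Context: For $\alpha>0$ let $U(x)=\sum_{i=1}^n\frac14x_i^4+\frac{\beta-\alpha^2}{2}x^Tx-\frac12x^TSx$ on $\mathbb{R}^n$, and let $E(v)=-\frac12v^TSv$ for $v\in\{-1,1\}^n$. $\operatorname{sgn}(x)$ is the componentwise sign vector. A constant $\alpha_*>0$ (depending on $\beta,S$) is an admissible threshold if for every $\alpha>\alpha_*$: $U$ has exactly $3^n$ critical points and exactly $2^n$ local minimum points, the set of signum vectors of the local minimum points is $\{-1,1\}^n$, and the signum vector of every global minimum point of $U$ minimizes $E$ on $\{-1,1\}^n$. The Morse index of a critical point is the number of negative eigenvalues of the Hessian there, counted with multiplicity. $\mathcal{C}(U)$ is the set of critical points of $U$, $\mathcal{C}_0(U)$ the set of local minimum points (Morse index $0$), $\mathcal{C}_s(U)$ the set of saddles (Morse index strictly between $0$ and $n$), and $U_s=\min_{x\in\mathcal{C}_s(U)}U(x)$. The system considered is the autonomous Hamiltonian system $\dot x_i=y_i$, $\dot y_i=-(x_i^2+\beta-\alpha^2)x_i+\sum_{j=1}^ns_{ij}x_j$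 ($1\le i\le n$), with Hamiltonian $H(x,y)=\sum_{i=1}^n\frac12y_i^2+U(x)$, which is constant along solutions. An orbit is the component $x(t)$ of a solution $(x(t),y(t))$; its Hamiltonian energy is the constant value of $H$. Hill's region is $\mathcal{R}_c=\{x\in\mathbb{R}^n: U(x)<c\}$; an orbit in $\mathcal{R}_c$ is an orbit $x(t)\in C^2(\mathbb{R},\mathcal{R}_c)$. For $x\in\mathcal{C}_0(U)$, a "neighborhood of minimum point" $\mathcal{N}(x)$ is a path-connected neighborhood $N$ of $x$ such that $N\cap\mathcal{C}(U)=\{x\}$, $D^2U$ is positive definite on $N$, and $\operatorname{sgn}(a)=\operatorname{sgn}(x)$ for all $a\in N$. An orbit $x(t)$ is transit on $I\subset\mathbb{R}$ if there exist $t_1,t_2\in I$, two different local minimum points $x_1,x_2$ and corresponding neighborhoods of minimum point $\mathcal{N}(x_1),\mathcal{N}(x_2)$ with $x(t_1)\in\mathcal{N}(x_1)$ and $x(t_2)\in\mathcal{N}(x_2)$; it is a transit orbit if it is transit on some $I\subset\mathbb{R}$. An orbit $x(t)$ is capture if there exist $t_3$ and $x_3\in\mathcal{C}_0(U)$ (with a neighborhood of minimum point $\mathcal{N}(x_3)$) such that $x(t_3)\in\mathcal{N}(x_3)$ and, for all $t\ge t_3$, $x(t)\notin\mathcal{N}(x_4)$ for every $x_4\in\mathcal{C}_0(U)\setminus\{x_3\}$ and every neighborhood of minimum point $\mathcal{N}(x_4)$. *)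

theory Defs
  imports "HOL-Analysis.Analysis" "HOL-Computational_Algebra.Polynomial"
begin

section \<open>Critical points, Hessian and Morse index\<close>

definition critical_points :: "('a::real_normed_vector \<Rightarrow> real) \<Rightarrow> 'a set" where
  "critical_points f = {x. (f has_derivative (\<lambda>h. 0)) (at x)}"

definition local_min_points :: "('a::topological_space \<Rightarrow> real) \<Rightarrow> 'a set" where
  "local_min_points f = {x. \<forall>\<^sub>F y in nhds x. f x \<le> f y}"

definition global_min_points :: "('a \<Rightarrow> real) \<Rightarrow> 'a set" where
  "global_min_points f = {x. \<forall>y. f x \<le> f y}"

definition partial_deriv :: "'n \<Rightarrow> (real ^ 'n \<Rightarrow> real) \<Rightarrow> real ^ 'n \<Rightarrow> real" where
  "partial_deriv i f x = frechet_derivative f (at x) (axis i 1)"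

definition hessian :: "(real ^ 'n \<Rightarrow> real) \<Rightarrow> real ^ 'n \<Rightarrow> real ^ 'n ^ 'n" where
  "hessian f x = (\<chi> i j. partial_deriv i (partial_deriv j f) x)"

definition pos_def :: "real ^ 'n ^ 'n \<Rightarrow> bool" where
  "pos_def A \<longleftrightarrow> (\<forall>h. h \<noteq> 0 \<longrightarrow> h \<bullet> (A *v h) > 0)"

definition char_poly_vec :: "real ^ 'n ^ 'n \<Rightarrow> real poly" where
  "char_poly_vec A = det (\<chi> i j. (if i = j then [:0, 1:] else 0) - [:A $ i $ j:])"

text \<open>\<^const>\<open>proots\<close> gives the multiset of roots, so eigenvalues are counted with their
  multiplicity as roots of the characteristic polynomial.\<close>

definition morse_index :: "(real ^ 'n \<Rightarrow> real) \<Rightarrow> real ^ 'n \<Rightarrow> nat" where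
  "morse_index f x = size {# l \<in># proots (char_poly_vec (hessian f x)). l < 0 #}"

definition saddle_points :: "(real ^ 'n \<Rightarrow> real) \<Rightarrow> (real ^ 'n) set" where
  "saddle_points f =
     {x \<in> critical_points f. 0 < morse_index f x \<and> morse_index f x < CARD('n)}"

text \<open>\<^const>\<open>Min\<close> is only meaningful for a finite nonempty set; finiteness of the critical set
  is part of the notion of admissible threshold below.\<close>

definition min_saddle_value :: "(real ^ 'n \<Rightarrow> real) \<Rightarrow> real" where
  "min_saddle_value f = Min (f ` saddle_points f)"


section \<open>The potential, the energy on sign vectors, admissible thresholds\<close>

definition potential :: "real \<Rightarrow> real \<Rightarrow> real ^ 'n ^ 'n \<Rightarrow> real ^ 'n \<Rightarrow> real" where
  "potential \<alpha> \<beta> S x =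
     (\<Sum>i\<in>UNIV. 1 / 4 * (x $ i) ^ 4) + (\<beta> - \<alpha>\<^sup>2) / 2 * (x \<bullet> x) - 1 / 2 * (x \<bullet> (S *v x))"

definition ising_energy :: "real ^ 'n ^ 'n \<Rightarrow> real ^ 'n \<Rightarrow> real" where
  "ising_energy S v = - (1 / 2) * (v \<bullet> (S *v v))"

definition sign_vectors :: "(real ^ 'n) set" where
  "sign_vectors = {v. \<forall>i. v $ i \<in> {-1, 1}}"

text \<open>Componentwise signs; the overloaded \<^const>\<open>sgn\<close> on vectors normalises instead.\<close>

definition signum_vec :: "real ^ 'n \<Rightarrow> real ^ 'n" where
  "signum_vec x = (\<chi> i. sgn (x $ i))"

text \<open>The cardinalities below are positive, hence both sets are finite.\<close>

definition admissible_threshold :: "real \<Rightarrow> real ^ 'n ^ 'n \<Rightarrow> real \<Rightarrow> bool" where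
  "admissible_threshold \<beta> S \<alpha>s \<longleftrightarrow> \<alpha>s > 0 \<and>
     (\<forall>\<alpha>>\<alpha>s.
        card (critical_points (potential \<alpha> \<beta> S)) = 3 ^ CARD('n) \<and>
        card (local_min_points (potential \<alpha> \<beta> S)) = 2 ^ CARD('n) \<and>
        signum_vec ` local_min_points (potential \<alpha> \<beta> S) = sign_vectors \<and>
        (\<forall>x \<in> global_min_points (potential \<alpha> \<beta> S).
           is_arg_min (ising_energy S) (\<lambda>v. v \<in> sign_vectors) (signum_vec x)))"


section \<open>The Hamiltonian system and its orbits\<close>

definition is_solution ::
  "real \<Rightarrow> real \<Rightarrow> real ^ 'n ^ 'n \<Rightarrow> (real \<Rightarrow> real ^ 'n) \<Rightarrow> (real \<Rightarrow> real ^ 'n) \<Rightarrow> bool" where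
  "is_solution \<alpha> \<beta> S x y \<longleftrightarrow>
     (\<forall>t. (x has_vector_derivative y t) (at t) \<and>
          (y has_vector_derivative
             (\<chi> i. - ((x t $ i)\<^sup>2 + \<beta> - \<alpha>\<^sup>2) * x t $ i + (\<Sum>j\<in>UNIV. S $ i $ j * x t $ j))) (at t))"

definition hamiltonian ::
  "real \<Rightarrow> real \<Rightarrow> real ^ 'n ^ 'n \<Rightarrow> real ^ 'n \<Rightarrow> real ^ 'n \<Rightarrow> real" where
  "hamiltonian \<alpha> \<beta> S x y = (\<Sum>i\<in>UNIV. 1 / 2 * (y $ i)\<^sup>2) + potential \<alpha> \<beta> S x"

definition orbit_with_energy ::
  "real \<Rightarrow> real \<Rightarrow> real ^ 'n ^ 'n \<Rightarrow> real \<Rightarrow> (real \<Rightarrow> real ^ 'n) \<Rightarrow> bool" where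
  "orbit_with_energy \<alpha> \<beta> S c x \<longleftrightarrow>
     (\<exists>y. is_solution \<alpha> \<beta> S x y \<and> (\<forall>t. hamiltonian \<alpha> \<beta> S (x t) (y t) = c))"

definition hill_region :: "real \<Rightarrow> real \<Rightarrow> real ^ 'n ^ 'n \<Rightarrow> real \<Rightarrow> (real ^ 'n) set" where
  "hill_region \<alpha> \<beta> S c = {x. potential \<alpha> \<beta> S x < c}"

text \<open>Solutions live on all of \<open>\<real>\<close> and the vector field is smooth, so \<open>x\<close> is automatically
  \<open>C\<^sup>2\<close>.\<close>

definition orbit_in_hill_region ::
  "real \<Rightarrow> real \<Rightarrow> real ^ 'n ^ 'n \<Rightarrow> real \<Rightarrow> (real \<Rightarrow> real ^ 'n) \<Rightarrow> bool" where
  "orbit_in_hill_region \<alpha> \<beta> S c x \<longleftrightarrow>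
     orbit_with_energy \<alpha> \<beta> S c x \<and> (\<forall>t. x t \<in> hill_region \<alpha> \<beta> S c)"


section \<open>Transit and capture orbits\<close>

definition min_nbhd :: "(real ^ 'n \<Rightarrow> real) \<Rightarrow> real ^ 'n \<Rightarrow> (real ^ 'n) set \<Rightarrow> bool" where
  "min_nbhd f x N \<longleftrightarrow>
     x \<in> interior N \<and> path_connected N \<and> N \<inter> critical_points f = {x} \<and>
     (\<forall>a\<in>N. pos_def (hessian f a)) \<and> (\<forall>a\<in>N. signum_vec a = signum_vec x)"

definition transit_on ::
  "(real ^ 'n \<Rightarrow> real) \<Rightarrow> real set \<Rightarrow> (real \<Rightarrow> real ^ 'n) \<Rightarrow> bool" where
  "transit_on f I x \<longleftrightarrow>
     (\<exists>t1\<in>I. \<exists>t2\<in>I. \<exists>x1\<in>local_min_points f. \<exists>x2\<in>local_min_points f. \<exists>N1 N2.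
        x1 \<noteq> x2 \<and> min_nbhd f x1 N1 \<and> min_nbhd f x2 N2 \<and> x t1 \<in> N1 \<and> x t2 \<in> N2)"

definition transit :: "(real ^ 'n \<Rightarrow> real) \<Rightarrow> (real \<Rightarrow> real ^ 'n) \<Rightarrow> bool" where
  "transit f x \<longleftrightarrow> (\<exists>I. transit_on f I x)"

definition capture :: "(real ^ 'n \<Rightarrow> real) \<Rightarrow> (real \<Rightarrow> real ^ 'n) \<Rightarrow> bool" where
  "capture f x \<longleftrightarrow>
     (\<exists>t3. \<exists>x3\<in>local_min_points f. \<exists>N3.
        min_nbhd f x3 N3 \<and> x t3 \<in> N3 \<and>
        (\<forall>t\<ge>t3. \<forall>x4\<in>local_min_points f - {x3}. \<forall>N4. min_nbhd f x4 N4 \<longrightarrow> x t \<notin> N4))"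

end

(*
Rescaling x = a u with a = sqrt(alpha^2 - beta) turns U into a^4 V, where V is a sum of double wells
u_i^4/4 - u_i^2/2 plus a coupling of size 1/a^2. For weak coupling there is one critical point
near each vector in {-1,0,1}^n, the local minima being those near {-1,1}^n.

Below the saddle energy an orbit cannot meet the hypersurface dV/du_i = 0 near u_i = 0: a minimax
argument bounds V there from below by its value at a saddle with a single zero sign. Hence no
coordinate can travel from one well to the other, which excludes transit.

For capture one needs a time at which every |u_i| exceeds 0.579 > 1/sqrt 3, so that the Hessian is
positive definite. A single coordinate cannot stay below this value forever, since it would be
a bounded strictly convex or concave function of time. If at every time some coordinate is below,
then at some time the role passes from i to j, both being below. The energy left then is so small
that the two coordinates behave like independent oscillators for a while, and i stays above for
longer than j can stay below.
*)
theory Submission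
  imports Defs
begin

section \<open>Symmetric matrices and the Morse index\<close>

text \<open>Energy alone does not give capture: for energies close to \<open>U_s\<close> the Hill
  region reaches outside the set where the Hessian is positive definite. Measured from the bottom of
  the wells, a rescaled orbit has energy at most about 1/4, the height of one barrier, while a
  coordinate with |u_i| = 0.579 costs about 0.1105. So two coordinates may be inside this radius at
  once, but never three, and the case of two has to be settled by time scales. That comparison runs
  forward in time; since the good time of a coordinate may lie in the past, the reversed orbit is
  used as well. The value of \<open>U_s\<close> is never determined. It suffices that critical
  points with exactly one zero sign are saddles, for then \<open>U_s\<close> is at most their
  energy; two diagonal Hessian entries of opposite sign show this without diagonalisation.\<close>

lemma poly_char_poly_vec: "poly (char_poly_vec A) l = det (mat l - A)"
proof -
  have "poly ((if i = j then [:0, 1:] else 0) - [:A $ i $ j:]) l = (mat l - A) $ i $ j" for i j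
    by (simp add: mat_def)
  then show ?thesis
    by (simp add: char_poly_vec_def det_def poly_sum poly_prod)
qed

lemma poly_char_poly_vec_eq_0_iff:
  fixes A :: "real ^ 'n ^ 'n"
  shows "poly (char_poly_vec A) l = 0 \<longleftrightarrow> (\<exists>v. v \<noteq> 0 \<and> A *v v = l *\<^sub>R v)"
proof -
  have mat: "(mat l - A) *v v = l *\<^sub>R v - A *v v" for v
    by (simp add: matrix_vector_mult_def mat_def vec_eq_iff left_diff_distrib sum_subtractf
        if_distrib [where f = "\<lambda>x. x * _"] cong: if_cong)
  have "poly (char_poly_vec A) l = 0 \<longleftrightarrow> \<not> invertible (mat l - A)"
    by (simp add: poly_char_poly_vec invertible_det_nz)
  also have "\<dots> \<longleftrightarrow> (\<exists>v. v \<noteq> 0 \<and> (mat l - A) *v v = 0)"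
    unfolding invertible_left_inverse matrix_left_invertible_ker by blast
  finally show ?thesis
    by (auto simp: mat)
qed

lemma degree_char_poly_vec_le: "degree (char_poly_vec (A :: real ^ 'n ^ 'n)) \<le> CARD('n)"
  unfolding char_poly_vec_def det_def
proof (rule degree_sum_le)
  fix p :: "'n \<Rightarrow> 'n"
  let ?M = "\<chi> i j. (if i = j then [:0, 1:] else 0) - [:A $ i $ j:]"
  have "degree (\<Prod>i\<in>UNIV. ?M $ i $ p i) \<le> (\<Sum>i\<in>UNIV. degree (?M $ i $ p i))"
    using degree_prod_sum_le [of UNIV "\<lambda>i. ?M $ i $ p i"] by (simp add: o_def)
  also have "\<dots> \<le> (\<Sum>i\<in>(UNIV :: 'n set). 1)"
    by (intro sum_mono) auto
  finally have "degree (\<Prod>i\<in>UNIV. ?M $ i $ p i) \<le> CARD('n)" by simp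
  moreover have "degree (of_int (sign p) :: real poly) = 0"
    by simp
  ultimately show "degree (of_int (sign p) * (\<Prod>i\<in>UNIV. ?M $ i $ p i)) \<le> CARD('n)"
    using degree_mult_le [of "of_int (sign p) :: real poly" "\<Prod>i\<in>UNIV. ?M $ i $ p i"] by linarith
qed simp

text \<open>No eigenvalue exceeds the operator norm, so the norm plus one is not a root. Only for a
  nonzero polynomial does \<open>proots\<close> list exactly the roots.\<close>

lemma char_poly_vec_nonzero: "char_poly_vec (A :: real ^ 'n ^ 'n) \<noteq> 0"
proof
  assume "char_poly_vec A = 0"
  then obtain v where "v \<noteq> 0" and v: "A *v v = (onorm ((*v) A) + 1) *\<^sub>R v"
    using poly_char_poly_vec_eq_0_iff [of A "onorm ((*v) A) + 1"] by auto
  have "norm (A *v v) \<le> onorm ((*v) A) * norm v"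
    by (simp add: onorm matrix_vector_mul_bounded_linear)
  moreover have "norm (A *v v) = (onorm ((*v) A) + 1) * norm v"
    using onorm_pos_le [OF matrix_vector_mul_bounded_linear, of A] by (simp add: v)
  ultimately show False
    using \<open>v \<noteq> 0\<close> by (simp add: algebra_simps)
qed

lemma symmetric_inner_swap:
  fixes A :: "real ^ 'n ^ 'n"
  assumes "transpose A = A"
  shows "v \<bullet> (A *v w) = w \<bullet> (A *v v)"
proof -
  have "v v* A = A *v v"
    using transpose_matrix_vector [of A v] unfolding assms by (rule sym)
  then show ?thesis
    using dot_lmul_matrix [of v A w] by (simp only: inner_commute)
qed

text \<open>The quadratic form attains its minimum on the unit sphere by compactness, and a nonzero
  residual at the minimiser would be a descent direction.\<close>

lemma symmetric_least_eigenvalue: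
  fixes A :: "real ^ 'n ^ 'n"
  assumes sym: "transpose A = A"
  obtains v l where "v \<noteq> 0" "A *v v = l *\<^sub>R v" "\<And>w. l * (w \<bullet> w) \<le> w \<bullet> (A *v w)"
proof -
  have "continuous_on (sphere 0 1) (\<lambda>v. v \<bullet> (A *v v))"
    by (intro continuous_intros matrix_vector_mult_linear_continuous_on)
  moreover have "sphere 0 1 \<noteq> ({} :: (real ^ 'n) set)" by simp
  ultimately obtain v where "v \<in> sphere 0 1"
      and "\<forall>w \<in> sphere 0 1. v \<bullet> (A *v v) \<le> w \<bullet> (A *v w)"
    using continuous_attains_inf [OF compact_sphere] by blast
  then have v: "norm v = 1"
    and min: "\<And>w. norm w = 1 \<Longrightarrow> v \<bullet> (A *v v) \<le> w \<bullet> (A *v w)"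
    by auto
  define l where "l = v \<bullet> (A *v v)"
  have vv: "v \<bullet> v = 1"
    using v by (simp add: norm_eq_1)
  have ge: "l * (w \<bullet> w) \<le> w \<bullet> (A *v w)" for w
  proof (cases "w = 0")
    case False
    then have "l \<le> (w /\<^sub>R norm w) \<bullet> (A *v (w /\<^sub>R norm w))"
      unfolding l_def by (intro min) simp
    also have "\<dots> = (w \<bullet> (A *v w)) / (w \<bullet> w)"
      by (simp add: matrix_vector_mult_scaleR dot_square_norm power2_eq_square field_simps)
    finally show ?thesis
      using False by (simp add: field_simps)
  qed simp
  have "A *v v - l *\<^sub>R v = 0"
  proof (rule ccontr)
    define w where "w = A *v v - l *\<^sub>R v"
    assume "A *v v - l *\<^sub>R v \<noteq> 0"
    then have ww: "w \<bullet> w > 0" by (simp add: w_def)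
    define q where "q = w \<bullet> (A *v w) - l * (w \<bullet> w)"
    have "q \<ge> 0" using ge [of w] by (simp add: q_def)
    have expand: "(v + t *\<^sub>R w) \<bullet> (A *v (v + t *\<^sub>R w)) - l * ((v + t *\<^sub>R w) \<bullet> (v + t *\<^sub>R w))
        = 2 * t * (w \<bullet> w) + t\<^sup>2 * q" for t
    proof -
      have "v \<bullet> (A *v w) = w \<bullet> (A *v v)"
        by (rule symmetric_inner_swap [OF sym])
      moreover have "w \<bullet> (A *v v) = w \<bullet> w + l * (w \<bullet> v)"
        by (subst (2) w_def) (simp add: inner_diff_right)
      ultimately show ?thesis
        by (simp add: q_def inner_add_left inner_add_right matrix_vector_right_distrib
            matrix_vector_mult_scaleR l_def [symmetric] vv inner_commute [of v w] power2_eq_square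
            algebra_simps)
    qed
    \<comment> \<open>The perturbed form is quadratic in \<open>t\<close>; its minimiser would be
      \<open>- (w \<bullet> w) / q\<close>, and \<open>q + 1\<close> avoids a division by
      zero.\<close>
    define t where "t = - (w \<bullet> w) / (q + 1)"
    have "0 \<le> 2 * t * (w \<bullet> w) + t\<^sup>2 * q"
      using ge [of "v + t *\<^sub>R w"] expand [of t] by linarith
    also have "\<dots> = - (t\<^sup>2 * (q + 2))"
    proof -
      have "w \<bullet> w = - t * (q + 1)"
        using \<open>q \<ge> 0\<close> by (simp add: t_def)
      then show ?thesis
        by (simp only:) (simp add: power2_eq_square algebra_simps)
    qed
    also have "\<dots> < 0"
      using \<open>q \<ge> 0\<close> ww by (simp add: t_def)
    finally show False by simp
  qed
  then have "A *v v = l *\<^sub>R v" by simp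
  moreover have "v \<noteq> 0" using v by auto
  ultimately show thesis using ge that by blast
qed

lemma has_negative_eigenvalue:
  fixes A :: "real ^ 'n ^ 'n"
  assumes "transpose A = A" "A $ i $ i < 0"
  shows "\<exists>l<0. poly (char_poly_vec A) l = 0"
proof -
  obtain v l where vl: "v \<noteq> 0" "A *v v = l *\<^sub>R v" "\<And>w. l * (w \<bullet> w) \<le> w \<bullet> (A *v w)"
    using symmetric_least_eigenvalue [OF assms(1)] by blast
  have "axis i 1 \<bullet> (A *v axis i 1) = A $ i $ i"
    by (simp add: inner_axis' matrix_vector_mul_component inner_axis)
  with vl(3) [of "axis i 1"] assms(2) have "l < 0"
    by (simp add: inner_axis')
  with vl show ?thesis
    by (auto simp: poly_char_poly_vec_eq_0_iff)
qed

lemma has_positive_eigenvalue: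
  fixes A :: "real ^ 'n ^ 'n"
  assumes "transpose A = A" "A $ i $ i > 0"
  shows "\<exists>l>0. poly (char_poly_vec A) l = 0"
proof -
  have neg: "(- A) *v v = - (A *v v)" for v
    by (simp add: matrix_vector_mult_def vec_eq_iff sum_negf)
  have "transpose (- A) = - A"
    using assms(1) by (simp add: transpose_def vec_eq_iff)
  then obtain l where "l < 0" "poly (char_poly_vec (- A)) l = 0"
    using has_negative_eigenvalue [of "- A" i] assms(2) by auto
  then obtain v where "v \<noteq> 0" "A *v v = (- l) *\<^sub>R v"
    by (auto simp: poly_char_poly_vec_eq_0_iff neg neg_eq_iff_add_eq_0 eq_neg_iff_add_eq_0)
  with \<open>l < 0\<close> show ?thesis
    by (intro exI [of _ "- l"]) (auto simp: poly_char_poly_vec_eq_0_iff)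
qed

text \<open>The roots, counted with multiplicity, number at most the degree, so a single positive
  root keeps the count of negative ones below n.\<close>

lemma morse_index_strictly_between:
  fixes f :: "real ^ 'n \<Rightarrow> real"
  assumes sym: "transpose (hessian f x) = hessian f x"
    and "hessian f x $ i $ i < 0" "hessian f x $ j $ j > 0"
  shows "0 < morse_index f x" "morse_index f x < CARD('n)"
proof -
  let ?p = "char_poly_vec (hessian f x)"
  have roots: "set_mset (proots ?p) = {l. poly ?p l = 0}"
    by (simp add: char_poly_vec_nonzero)
  obtain l where "l < 0" "l \<in># proots ?p"
    using has_negative_eigenvalue [OF assms(1,2)] roots by blast
  then have "l \<in># filter_mset (\<lambda>l. l < 0) (proots ?p)" by simp
  then show "0 < morse_index f x"
    unfolding morse_index_def by (metis count_empty count_greater_zero_iff gr0I less_irrefl size_eq_0_iff_empty)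
  obtain m where "m > 0" "m \<in># proots ?p"
    using has_positive_eigenvalue [OF assms(1,3)] roots by blast
  then have "filter_mset (\<lambda>l. l < 0) (proots ?p) \<subset># proots ?p"
    by (metis filter_mset_eq_conv multiset_filter_subset order_less_asym subset_mset.le_neq_trans)
  then have "morse_index f x < size (proots ?p)"
    unfolding morse_index_def by (rule mset_subset_size)
  also have "\<dots> \<le> CARD('n)"
    using size_proots_le degree_char_poly_vec_le le_trans by blast
  finally show "morse_index f x < CARD('n)" .
qed

section \<open>Critical points of weakly coupled double wells\<close>

definition coupling_sum :: "real ^ 'n ^ 'n \<Rightarrow> real" where
  "coupling_sum S = 1 + (\<Sum>i\<in>UNIV. \<Sum>j\<in>UNIV. \<bar>S $ i $ j\<bar>)"

lemma coupling_sum_ge_1: "1 \<le> coupling_sum S"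
  by (simp add: coupling_sum_def sum_nonneg)

lemma sum_abs_mult_vec_le:
  fixes S :: "real ^ 'n ^ 'n"
  assumes "\<And>j. \<bar>v $ j\<bar> \<le> C"
  shows "(\<Sum>i\<in>UNIV. \<bar>(S *v v) $ i\<bar>) \<le> coupling_sum S * C"
proof -
  have "0 \<le> C" using assms [of undefined] by linarith
  have "(\<Sum>i\<in>UNIV. \<bar>(S *v v) $ i\<bar>) \<le> (\<Sum>i\<in>UNIV. \<Sum>j\<in>UNIV. \<bar>S $ i $ j\<bar> * C)"
    unfolding matrix_vector_mult_def
    by (simp, intro sum_mono order_trans [OF sum_abs])
      (simp add: abs_mult assms mult_left_mono sum_mono)
  also have "\<dots> = (coupling_sum S - 1) * C"
    by (simp add: coupling_sum_def sum_distrib_right)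
  also have "\<dots> \<le> coupling_sum S * C"
    using \<open>0 \<le> C\<close> by (simp add: algebra_simps)
  finally show ?thesis .
qed

lemma abs_mult_vec_le:
  fixes S :: "real ^ 'n ^ 'n"
  assumes "\<And>j. \<bar>v $ j\<bar> \<le> C"
  shows "\<bar>(S *v v) $ i\<bar> \<le> coupling_sum S * C"
  using sum_abs_mult_vec_le [OF assms] member_le_sum [of i UNIV "\<lambda>i. \<bar>(S *v v) $ i\<bar>"]
  by (meson UNIV_I abs_ge_zero finite order_trans)

lemma abs_bilinear_le:
  fixes S :: "real ^ 'n ^ 'n"
  assumes u: "\<And>j. \<bar>u $ j\<bar> \<le> B" and v: "\<And>j. \<bar>v $ j\<bar> \<le> C"
  shows "\<bar>u \<bullet> (S *v v)\<bar> \<le> coupling_sum S * B * C"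
proof -
  have "0 \<le> B" using u [of undefined] by linarith
  have "\<bar>u \<bullet> (S *v v)\<bar> \<le> (\<Sum>i\<in>UNIV. \<bar>u $ i * (S *v v) $ i\<bar>)"
    by (simp add: inner_vec_def sum_abs)
  also have "\<dots> \<le> (\<Sum>i\<in>UNIV. B * \<bar>(S *v v) $ i\<bar>)"
    by (intro sum_mono) (simp add: abs_mult u mult_right_mono)
  also have "\<dots> = B * (\<Sum>i\<in>UNIV. \<bar>(S *v v) $ i\<bar>)"
    by (simp add: sum_distrib_left)
  also have "\<dots> \<le> B * (coupling_sum S * C)"
    using \<open>0 \<le> B\<close> by (intro mult_left_mono sum_abs_mult_vec_le v)
  finally show ?thesis by (simp add: mult_ac)
qed

lemma norm_mult_vec_le:
  fixes S :: "real ^ 'n ^ 'n"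
  shows "norm (S *v v) \<le> coupling_sum S * norm v"
  using norm_le_l1_cart [of "S *v v"] sum_abs_mult_vec_le [of v "norm v" S] component_le_norm_cart
  by (meson order_trans)

lemma norm_sq_eq_sum: "(norm (h :: real ^ 'n))\<^sup>2 = (\<Sum>i\<in>UNIV. (h $ i)\<^sup>2)"
  unfolding power2_norm_eq_inner inner_vec_def by (simp add: power2_eq_square)

text \<open>Up to sign, \<open>s - s ^ 3\<close> is the product of \<open>s\<close>,
  \<open>s - 1\<close> and \<open>s + 1\<close>; if each exceeds 1/10 in modulus, the product
  exceeds 1/1000.\<close>

lemma near_cubic_root:
  fixes s :: real
  assumes "\<bar>s - s ^ 3\<bar> \<le> 1 / 10000"
  shows "\<bar>s\<bar> \<le> 1 / 10 \<or> \<bar>s - 1\<bar> \<le> 1 / 10 \<or> \<bar>s + 1\<bar> \<le> 1 / 10"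
proof (rule ccontr)
  assume "\<not> ?thesis"
  then have "1 / 10 * (1 / 10 * (1 / 10)) \<le> \<bar>s\<bar> * (\<bar>s - 1\<bar> * \<bar>s + 1\<bar>)"
    by (intro mult_mono) auto
  also have "\<dots> = \<bar>s - s ^ 3\<bar>"
    by (simp add: abs_mult [symmetric] abs_minus_commute algebra_simps power3_eq_cube)
  finally show False using assms by simp
qed

text \<open>The constant is far from optimal; the numerical margins are narrowest in the comparison of time
  scales in \<open>switch_impossible\<close> below.\<close>

locale weak_coupling =
  fixes S :: "real ^ 'n ^ 'n" and \<epsilon> :: real
  assumes sym: "transpose S = S"
    and diag: "\<And>i. S $ i $ i = 0"
    and eps_pos: "0 < \<epsilon>"
    and small: "\<epsilon> * coupling_sum S * (2 * CARD('n) + 2) \<le> 1 / 100000"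
begin

lemma eps_coupling: "\<epsilon> * coupling_sum S \<le> 1 / 400000"
proof -
  have "1 \<le> CARD('n)" by (simp add: Suc_leI)
  then have "\<epsilon> * coupling_sum S * 4 \<le> \<epsilon> * coupling_sum S * (2 * CARD('n) + 2)"
    using eps_pos coupling_sum_ge_1 [of S] by (intro mult_left_mono) auto
  with small show ?thesis by simp
qed

lemma abs_coupling_le:
  assumes "\<And>j. \<bar>v $ j\<bar> \<le> C"
  shows "\<bar>\<epsilon> * (S *v v) $ i\<bar> \<le> C / 400000"
proof -
  have "0 \<le> C" using assms [of undefined] by linarith
  have "\<bar>\<epsilon> * (S *v v) $ i\<bar> \<le> \<epsilon> * (coupling_sum S * C)"
    using abs_mult_vec_le [OF assms, of S i] eps_pos by (simp add: abs_mult)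
  also have "\<dots> \<le> 1 / 400000 * C"
    using mult_right_mono [OF eps_coupling \<open>0 \<le> C\<close>] by (simp add: mult_ac)
  finally show ?thesis by simp
qed

lemma abs_quadratic_le:
  assumes "\<And>j. \<bar>v $ j\<bar> \<le> C"
  shows "\<bar>\<epsilon> * (v \<bullet> (S *v v))\<bar> \<le> C\<^sup>2 / 400000"
proof -
  have "\<bar>\<epsilon> * (v \<bullet> (S *v v))\<bar> \<le> \<epsilon> * (coupling_sum S * C * C)"
    using abs_bilinear_le [OF assms assms, of S] eps_pos by (simp add: abs_mult)
  also have "\<dots> \<le> 1 / 400000 * (C * C)"
    using mult_right_mono [OF eps_coupling, of "C * C"] by (simp add: mult_ac)
  finally show ?thesis by (simp add: power2_eq_square)
qed

text \<open>Minus the gradient of \<open>pot\<close>, by symmetry of \<open>S\<close>.\<close>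

definition force :: "real ^ 'n \<Rightarrow> 'n \<Rightarrow> real" where
  "force u i = u $ i - (u $ i) ^ 3 + \<epsilon> * (S *v u) $ i"

definition pot :: "real ^ 'n \<Rightarrow> real" where
  "pot u = (\<Sum>i\<in>UNIV. (u $ i) ^ 4 / 4 - (u $ i)\<^sup>2 / 2) - \<epsilon> / 2 * (u \<bullet> (S *v u))"

text \<open>The potential is a quartic polynomial, so its Taylor expansion is exact, and the
  comparisons of energies at nearby points become algebra without derivatives.\<close>

lemma pot_expand:
  "pot (z + h) = pot z + (\<Sum>i\<in>UNIV. - force z i * h $ i + (3 * (z $ i)\<^sup>2 - 1) / 2 * (h $ i)\<^sup>2
     + z $ i * (h $ i) ^ 3 + (h $ i) ^ 4 / 4) - \<epsilon> / 2 * (h \<bullet> (S *v h))"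
proof -
  have "(\<Sum>i\<in>UNIV. ((z + h) $ i) ^ 4 / 4 - ((z + h) $ i)\<^sup>2 / 2) =
      (\<Sum>i\<in>UNIV. ((z $ i) ^ 4 / 4 - (z $ i)\<^sup>2 / 2) +
        (- force z i * h $ i + (3 * (z $ i)\<^sup>2 - 1) / 2 * (h $ i)\<^sup>2
          + z $ i * (h $ i) ^ 3 + (h $ i) ^ 4 / 4) + \<epsilon> * (h $ i * (S *v z) $ i))"
    by (intro sum.cong refl)
      (simp add: force_def field_simps power2_eq_square power3_eq_cube power4_eq_xxxx)
  also have "\<dots> = (\<Sum>i\<in>UNIV. (z $ i) ^ 4 / 4 - (z $ i)\<^sup>2 / 2) +
      (\<Sum>i\<in>UNIV. - force z i * h $ i + (3 * (z $ i)\<^sup>2 - 1) / 2 * (h $ i)\<^sup>2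
          + z $ i * (h $ i) ^ 3 + (h $ i) ^ 4 / 4) + \<epsilon> * (h \<bullet> (S *v z))"
    by (simp only: sum.distrib sum_distrib_left [symmetric]) (simp add: inner_vec_def)
  finally show ?thesis
    using symmetric_inner_swap [OF sym, of z h]
    by (simp add: pot_def matrix_vector_right_distrib inner_add_left inner_add_right algebra_simps)
qed

lemma pot_eq: "pot u = (\<Sum>i\<in>UNIV. ((u $ i)\<^sup>2 - 1)\<^sup>2 / 4) - CARD('n) / 4 - \<epsilon> / 2 * (u \<bullet> (S *v u))"
proof -
  have "(\<Sum>i\<in>UNIV. ((u $ i)\<^sup>2 - 1)\<^sup>2 / 4) = (\<Sum>i\<in>UNIV. ((u $ i) ^ 4 / 4 - (u $ i)\<^sup>2 / 2) + 1 / 4)"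
    by (intro sum.cong refl) (simp add: power2_eq_square power4_eq_xxxx field_simps)
  then show ?thesis
    by (simp add: pot_def sum.distrib)
qed

text \<open>Absorbing the coupling into half the squared norm leaves the sum of
  \<open>u^4 / 4 - u^2\<close>, which is \<open>(u^2 - 2)^2 / 4 - 1\<close>. So each
  \<open>(u^2 - 2)^2\<close> is at most 4n, and 4n \<le> (2n)^2 avoids a square root.\<close>

lemma pot_nonpos_component_le:
  assumes "pot u \<le> 0"
  shows "(u $ i)\<^sup>2 \<le> 2 * CARD('n) + 2"
proof -
  have "\<epsilon> * (u \<bullet> (S *v u)) \<le> (norm u)\<^sup>2 / 400000"
    using abs_quadratic_le [OF component_le_norm_cart, of u] by simp
  then have "(\<Sum>i\<in>UNIV. (u $ i) ^ 4 / 4 - (u $ i)\<^sup>2 / 2) \<le> (norm u)\<^sup>2 / 2"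
    using assms zero_le_power2 [of "norm u"] unfolding pot_def by linarith
  also have "\<dots> = (\<Sum>i\<in>UNIV. (u $ i)\<^sup>2 / 2)"
    by (simp add: norm_sq_eq_sum sum_divide_distrib)
  finally have "(\<Sum>i\<in>UNIV. (u $ i) ^ 4 / 4 - (u $ i)\<^sup>2 / 2) - (\<Sum>i\<in>UNIV. (u $ i)\<^sup>2 / 2) \<le> 0"
    by simp
  moreover have "(\<Sum>i\<in>UNIV. ((u $ i)\<^sup>2 - 2)\<^sup>2 / 4) =
     (\<Sum>i\<in>UNIV. (u $ i) ^ 4 / 4 - (u $ i)\<^sup>2 / 2) - (\<Sum>i\<in>UNIV. (u $ i)\<^sup>2 / 2) + CARD('n)"
  proof -
    have "(\<Sum>i\<in>UNIV. ((u $ i)\<^sup>2 - 2)\<^sup>2 / 4) =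
        (\<Sum>i\<in>UNIV. ((u $ i) ^ 4 / 4 - (u $ i)\<^sup>2 / 2) - (u $ i)\<^sup>2 / 2 + 1)"
      by (intro sum.cong refl) (simp add: power2_eq_square power4_eq_xxxx field_simps)
    then show ?thesis by (simp only: sum.distrib sum_subtractf) simp
  qed
  moreover have "((u $ i)\<^sup>2 - 2)\<^sup>2 / 4 \<le> (\<Sum>i\<in>UNIV. ((u $ i)\<^sup>2 - 2)\<^sup>2 / 4)"
    by (rule member_le_sum) auto
  ultimately have "((u $ i)\<^sup>2 - 2)\<^sup>2 \<le> 4 * real CARD('n)"
    by linarith
  also have "\<dots> \<le> (2 * real CARD('n))\<^sup>2"
    by (simp add: power2_eq_square)
  finally have "(u $ i)\<^sup>2 - 2 \<le> 2 * real CARD('n)"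
    by (rule power2_le_imp_le) simp
  then show ?thesis by simp
qed

text \<open>This is the reason for the factor \<open>2 * CARD('n) + 2\<close> in
  \<open>small\<close>: it makes the coupling negligible on a whole sublevel set and not only near
  the labels.\<close>

lemma pot_nonpos_bounds:
  assumes "pot u \<le> 0"
  shows "\<bar>\<epsilon> * (S *v u) $ i\<bar> \<le> 1 / 100000" "\<bar>\<epsilon> * (u \<bullet> (S *v u))\<bar> \<le> 1 / 100000"
proof -
  define B where "B = sqrt (2 * CARD('n) + 2)"
  have B: "\<bar>u $ j\<bar> \<le> B" for j
    using pot_nonpos_component_le [OF assms, of j] unfolding B_def
    by (metis real_sqrt_abs real_sqrt_le_iff of_nat_add of_nat_mult of_nat_numeral)
  have BB: "B * B = 2 * CARD('n) + 2" by (simp add: B_def)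
  have "1 \<le> B" by (simp add: B_def)
  then have "B \<le> B * B" by simp
  have L: "0 \<le> \<epsilon> * coupling_sum S"
    using eps_pos coupling_sum_ge_1 [of S] by simp
  have "\<bar>\<epsilon> * (S *v u) $ i\<bar> \<le> \<epsilon> * (coupling_sum S * B)"
    using abs_mult_vec_le [OF B, of S i] eps_pos by (simp add: abs_mult)
  also have "\<dots> \<le> \<epsilon> * coupling_sum S * (B * B)"
    using mult_left_mono [OF \<open>B \<le> B * B\<close> L] by (simp add: mult_ac)
  finally show "\<bar>\<epsilon> * (S *v u) $ i\<bar> \<le> 1 / 100000"
    using small by (simp add: BB)
  have "\<bar>\<epsilon> * (u \<bullet> (S *v u))\<bar> \<le> \<epsilon> * (coupling_sum S * B * B)"
    using abs_bilinear_le [OF B B, of S] eps_pos by (simp add: abs_mult)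
  also have "\<dots> = \<epsilon> * coupling_sum S * (B * B)"
    by (simp add: mult_ac)
  finally show "\<bar>\<epsilon> * (u \<bullet> (S *v u))\<bar> \<le> 1 / 100000"
    using small by (simp add: BB)
qed

end

section \<open>Sign patterns that index the critical points\<close>

definition labels :: "(real ^ 'n) set" where
  "labels = {v. \<forall>i. v $ i \<in> {-1, 0, 1}}"

lemma card_vec_components_in:
  assumes "finite B"
  shows "card {v :: 'a ^ 'n. \<forall>i. v $ i \<in> B} = card B ^ CARD('n)"
proof -
  have "bij_betw (\<lambda>v. \<lambda>i. v $ i) {v :: 'a ^ 'n. \<forall>i. v $ i \<in> B} (UNIV \<rightarrow>\<^sub>E B)"
    by (rule bij_betwI [where g = vec_lambda]) auto
  then show ?thesis
    by (simp add: bij_betw_same_card card_funcsetE)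
qed

lemma card_labels: "card (labels :: (real ^ 'n) set) = 3 ^ CARD('n)"
  unfolding labels_def by (subst card_vec_components_in) (auto simp: eval_nat_numeral)

lemma card_sign_vectors: "card (sign_vectors :: (real ^ 'n) set) = 2 ^ CARD('n)"
  unfolding sign_vectors_def by (subst card_vec_components_in) (auto simp: eval_nat_numeral)

lemma finite_sign_vectors: "finite (sign_vectors :: (real ^ 'n) set)"
  by (rule card_ge_0_finite) (simp add: card_sign_vectors)

lemma sign_vectors_subset_labels: "sign_vectors \<subseteq> labels"
  by (auto simp: sign_vectors_def labels_def)

definition near :: "real ^ 'n \<Rightarrow> real ^ 'n \<Rightarrow> bool" where
  "near \<sigma> u \<longleftrightarrow> (\<forall>i. \<bar>u $ i - \<sigma> $ i\<bar> \<le> 1 / 10)"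

lemma near_sign_bounds:
  fixes s t :: real
  assumes "\<bar>t - s\<bar> \<le> 1 / 10" "s = -1 \<or> s = 1"
  shows "9 / 10 \<le> \<bar>t\<bar>" "\<bar>t\<bar> \<le> 11 / 10"
  using assms by (auto simp: abs_if split: if_splits)

lemma near_label_unique:
  assumes "near \<sigma> u" "near \<tau> u" "\<sigma> \<in> labels" "\<tau> \<in> labels"
  shows "\<sigma> = \<tau>"
proof -
  have "\<sigma> $ i = \<tau> $ i" for i
  proof -
    have "\<bar>u $ i - \<sigma> $ i\<bar> \<le> 1 / 10" "\<bar>u $ i - \<tau> $ i\<bar> \<le> 1 / 10"
      "\<sigma> $ i \<in> {-1, 0, 1}" "\<tau> $ i \<in> {-1, 0, 1}"
      using assms by (auto simp: near_def labels_def)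
    then show ?thesis by (auto simp: abs_if split: if_splits)
  qed
  then show ?thesis by (simp add: vec_eq_iff)
qed

definition one_zero :: "real ^ 'n \<Rightarrow> 'n \<Rightarrow> bool" where
  "one_zero \<sigma> i \<longleftrightarrow> \<sigma> $ i = 0 \<and> (\<forall>j. j \<noteq> i \<longrightarrow> \<sigma> $ j \<in> {-1, 1})"

lemma one_zero_label: "one_zero \<sigma> i \<Longrightarrow> \<sigma> \<in> labels"
  by (auto simp: one_zero_def labels_def)

context weak_coupling
begin

section \<open>One critical point for each label\<close>

definition crit :: "real ^ 'n \<Rightarrow> bool" where
  "crit u \<longleftrightarrow> (\<forall>i. force u i = 0)"

text \<open>The relaxation factors \<open>-1\<close> and \<open>1/2\<close> approximate \<open>1 / (3 s\<^sup>2 - 1)\<close> at \<open>s = 0\<close> and \<open>s = \<plusminus>1\<close>,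
  so this is a Newton-like contraction of the box around \<open>\<sigma>\<close>.\<close>

lemma ex1_crit_near:
  assumes \<sigma>: "\<sigma> \<in> labels"
  shows "\<exists>!u. near \<sigma> u \<and> crit u"
proof -
  define c where "c i = (if \<sigma> $ i = 0 then -1 else 1 / 2 :: real)" for i
  define T where "T u = (\<chi> i. u $ i + c i * force u i)" for u
  define g where "g i s = s + c i * (s - s ^ 3)" for i and s :: real
  have c: "\<bar>c i\<bar> \<le> 1" "c i \<noteq> 0" for i by (auto simp: c_def)
  have T: "T u $ i = g i (u $ i) + c i * (\<epsilon> * (S *v u) $ i)" for u i
    by (simp add: T_def g_def force_def algebra_simps)
  have fixed: "T u = u \<longleftrightarrow> crit u" for u
    using c(2) by (simp add: T_def crit_def vec_eq_iff)
  \<comment> \<open>The difference quotient of \<open>g i\<close> near label 0 is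
    \<open>s^2 + s t + t^2\<close>, at most 0.03. Near 1 and -1 this sum lies between 2.43 and 3.63,
    and the quotient \<open>1.5 - (s^2 + s t + t^2) / 2\<close> between -0.315 and 0.285.\<close>
  have g: "\<bar>g i s - g i t\<bar> \<le> 32 / 100 * \<bar>s - t\<bar>"
    if "\<bar>s - \<sigma> $ i\<bar> \<le> 1 / 10" "\<bar>t - \<sigma> $ i\<bar> \<le> 1 / 10" for i s t
  proof -
    have eq: "g i s - g i t = (1 + c i * (1 - (s\<^sup>2 + s * t + t\<^sup>2))) * (s - t)"
      by (simp add: g_def power2_eq_square power3_eq_cube algebra_simps)
    have "\<sigma> $ i \<in> {-1, 0, 1}" using \<sigma> by (simp add: labels_def)
    then consider "\<sigma> $ i = 0" | "\<sigma> $ i = 1" | "\<sigma> $ i = -1" by auto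
    then have "\<bar>1 + c i * (1 - (s\<^sup>2 + s * t + t\<^sup>2))\<bar> \<le> 32 / 100"
    proof cases
      case 1
      then have "\<bar>s * s\<bar> \<le> 1 / 10 * (1 / 10)" "\<bar>s * t\<bar> \<le> 1 / 10 * (1 / 10)" "\<bar>t * t\<bar> \<le> 1 / 10 * (1 / 10)"
        unfolding abs_mult using that by (intro mult_mono; simp)+
      with 1 show ?thesis unfolding abs_le_iff by (simp add: c_def power2_eq_square)
    next
      case 2
      then have b: "9 / 10 \<le> s" "s \<le> 11 / 10" "9 / 10 \<le> t" "t \<le> 11 / 10"
        using that unfolding abs_le_iff by auto
      have "9 / 10 * (9 / 10) \<le> s * s" "9 / 10 * (9 / 10) \<le> s * t" "9 / 10 * (9 / 10) \<le> t * t"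
        "s * s \<le> 11 / 10 * (11 / 10)" "s * t \<le> 11 / 10 * (11 / 10)" "t * t \<le> 11 / 10 * (11 / 10)"
        using b by (intro mult_mono; simp)+
      with 2 show ?thesis unfolding abs_le_iff by (simp add: c_def power2_eq_square field_simps)
    next
      case 3
      then have b: "9 / 10 \<le> - s" "- s \<le> 11 / 10" "9 / 10 \<le> - t" "- t \<le> 11 / 10"
        using that unfolding abs_le_iff by auto
      have "9 / 10 * (9 / 10) \<le> - s * - s" "9 / 10 * (9 / 10) \<le> - s * - t" "9 / 10 * (9 / 10) \<le> - t * - t"
        "- s * - s \<le> 11 / 10 * (11 / 10)" "- s * - t \<le> 11 / 10 * (11 / 10)" "- t * - t \<le> 11 / 10 * (11 / 10)"
        using b by (intro mult_mono; simp)+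
      with 3 show ?thesis unfolding abs_le_iff by (simp add: c_def power2_eq_square field_simps)
    qed
    then show ?thesis
      unfolding eq abs_mult by (rule mult_right_mono) simp
  qed
  have "\<exists>!u. u \<in> {u. near \<sigma> u} \<and> T u = u"
  proof (rule Banach_fix [where c = "1 / 2"])
    have "{u. near \<sigma> u} = (\<Inter>i. {u. \<bar>u $ i - \<sigma> $ i\<bar> \<le> 1 / 10})"
      by (auto simp: near_def)
    also have "closed \<dots>"
      by (intro closed_INT ballI closed_Collect_le continuous_intros)
    finally show "complete {u. near \<sigma> u}"
      by (simp add: complete_eq_closed)
    have "near \<sigma> \<sigma>" by (simp add: near_def)
    then show "{u. near \<sigma> u} \<noteq> {}" by blast
    show "T ` {u. near \<sigma> u} \<subseteq> {u. near \<sigma> u}"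
    proof clarsimp
      fix u assume u: "near \<sigma> u"
      show "near \<sigma> (T u)"
        unfolding near_def
      proof
        fix i
        have \<sigma>i: "\<sigma> $ j \<in> {-1, 0, 1}" for j using \<sigma> by (simp add: labels_def)
        have "g i (\<sigma> $ i) = \<sigma> $ i"
          using \<sigma>i [of i] by (auto simp: g_def)
        then have "\<bar>g i (u $ i) - \<sigma> $ i\<bar> \<le> 32 / 100 * (1 / 10)"
          using g [of "u $ i" i "\<sigma> $ i"] u by (auto simp: near_def dest: spec [of _ i])
        moreover have "\<bar>u $ j\<bar> \<le> 2" for j
        proof -
          have "\<bar>u $ j - \<sigma> $ j\<bar> \<le> 1 / 10" using u by (simp add: near_def)
          then show ?thesis using \<sigma>i [of j] by (auto simp: abs_if split: if_splits)
        qed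
        then have "\<bar>\<epsilon> * (S *v u) $ i\<bar> \<le> 2 / 400000"
          by (rule abs_coupling_le)
        then have "\<bar>c i * (\<epsilon> * (S *v u) $ i)\<bar> \<le> 1 * (2 / 400000)"
          unfolding abs_mult [of "c i"] using c(1) by (intro mult_mono) auto
        ultimately show "\<bar>T u $ i - \<sigma> $ i\<bar> \<le> 1 / 10"
          unfolding T by linarith
      qed
    qed
    show "\<And>u v. u \<in> {u. near \<sigma> u} \<Longrightarrow> v \<in> {u. near \<sigma> u} \<Longrightarrow> dist (T u) (T v) \<le> 1 / 2 * dist u v"
    proof -
      fix u v assume "u \<in> {u. near \<sigma> u}" "v \<in> {u. near \<sigma> u}"
      then have near: "near \<sigma> u" "near \<sigma> v" by auto
      define d1 where "d1 = (\<chi> i. g i (u $ i) - g i (v $ i))"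
      define d2 where "d2 = (\<chi> i. c i * (\<epsilon> *\<^sub>R (S *v (u - v))) $ i)"
      have "norm (d1 $ i) \<le> norm (((32 / 100) *\<^sub>R (u - v)) $ i)" for i
      proof -
        have "norm (((32 / 100) *\<^sub>R (u - v)) $ i) = 32 / 100 * \<bar>u $ i - v $ i\<bar>"
          by (simp only: vector_scaleR_component vector_minus_component real_scaleR_def real_norm_def abs_mult)
        then show ?thesis
          using g [of "u $ i" i "v $ i"] near by (simp add: d1_def near_def)
      qed
      then have "norm d1 \<le> norm ((32 / 100) *\<^sub>R (u - v))"
        by (rule norm_le_componentwise_cart)
      then have "norm d1 \<le> 32 / 100 * norm (u - v)" by simp
      moreover have "norm (d2 $ i) \<le> norm ((\<epsilon> *\<^sub>R (S *v (u - v))) $ i)" for i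
        using c(1) [of i] by (simp add: d2_def abs_mult mult_left_le_one_le)
      then have "norm d2 \<le> norm (\<epsilon> *\<^sub>R (S *v (u - v)))"
        by (rule norm_le_componentwise_cart)
      moreover have "norm (\<epsilon> *\<^sub>R (S *v (u - v))) \<le> 1 / 400000 * norm (u - v)"
      proof -
        have "norm (\<epsilon> *\<^sub>R (S *v (u - v))) \<le> \<epsilon> * (coupling_sum S * norm (u - v))"
          using norm_mult_vec_le [of S "u - v"] eps_pos by simp
        also have "\<dots> \<le> 1 / 400000 * norm (u - v)"
          using mult_right_mono [OF eps_coupling norm_ge_zero [of "u - v"]] by (simp add: mult_ac)
        finally show ?thesis .
      qed
      moreover have "T u - T v = d1 + d2"
        by (simp add: vec_eq_iff T d1_def d2_def matrix_vector_mult_diff_distrib algebra_simps)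
      then have "norm (T u - T v) \<le> norm d1 + norm d2"
        by (simp add: norm_triangle_ineq)
      ultimately show "dist (T u) (T v) \<le> 1 / 2 * dist u v"
        unfolding dist_norm using norm_ge_zero [of "u - v"] by linarith
    qed
  qed auto
  then show ?thesis by (simp add: fixed)
qed

text \<open>At the coordinate of largest modulus the coupling is a tiny fraction of that coordinate
  and cannot balance the cube once the modulus exceeds 2. This bounds all coordinates, and then each
  one nearly solves \<open>s = s^3\<close>.\<close>

lemma crit_near_label:
  assumes u: "crit u"
  obtains \<sigma> where "\<sigma> \<in> labels" "near \<sigma> u"
proof -
  have "finite (range (\<lambda>j. \<bar>u $ j\<bar>))" by simp
  then have "Max (range (\<lambda>j. \<bar>u $ j\<bar>)) \<in> range (\<lambda>j. \<bar>u $ j\<bar>)"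
    by (rule Max_in) simp
  then obtain k where "Max (range (\<lambda>j. \<bar>u $ j\<bar>)) = \<bar>u $ k\<bar>"
    by blast
  then have k: "\<bar>u $ j\<bar> \<le> \<bar>u $ k\<bar>" for j
    by (metis Max_ge finite_class.finite_UNIV finite_imageI rangeI)
  define m where "m = \<bar>u $ k\<bar>"
  have "m \<le> 2"
  proof (rule ccontr)
    assume "\<not> m \<le> 2"
    then have m: "2 < m" by simp
    have "(u $ k) ^ 3 = u $ k + \<epsilon> * (S *v u) $ k"
      using u by (simp add: crit_def force_def algebra_simps)
    then have "\<bar>(u $ k) ^ 3\<bar> \<le> m + m / 400000"
      using abs_coupling_le [OF k, of k] unfolding m_def by linarith
    then have "m * (m * m) \<le> 2 * m"
      using m by (simp add: m_def power_abs power3_eq_cube abs_mult)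
    then have "m * m \<le> 2" using m by (simp add: mult.commute)
    moreover have "2 * 2 < m * m" using m by (intro mult_strict_mono) auto
    ultimately show False by simp
  qed
  then have u2: "\<bar>u $ j\<bar> \<le> 2" for j
    using k [of j] unfolding m_def by simp
  have "\<exists>s\<in>{-1, 0, 1}. \<bar>u $ i - s\<bar> \<le> 1 / 10" for i
  proof -
    have "u $ i - (u $ i) ^ 3 = - (\<epsilon> * (S *v u) $ i)"
      using u by (simp add: crit_def force_def algebra_simps)
    then have "\<bar>u $ i - (u $ i) ^ 3\<bar> \<le> 1 / 10000"
      using abs_coupling_le [OF u2, of i] by simp
    from near_cubic_root [OF this] show ?thesis by auto
  qed
  then obtain s where s: "\<And>i. s i \<in> {-1, 0, 1} \<and> \<bar>u $ i - s i\<bar> \<le> 1 / 10"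
    by metis
  show thesis
    by (rule that [of "\<chi> i. s i"]) (use s in \<open>auto simp: labels_def near_def\<close>)
qed

section \<open>Critical points as a function of the label, and energies near them\<close>

definition crit_pt :: "real ^ 'n \<Rightarrow> real ^ 'n" where
  "crit_pt \<sigma> = (THE u. near \<sigma> u \<and> crit u)"

lemma crit_pt: "\<sigma> \<in> labels \<Longrightarrow> near \<sigma> (crit_pt \<sigma>)" "\<sigma> \<in> labels \<Longrightarrow> crit (crit_pt \<sigma>)"
  using theI' [OF ex1_crit_near, of \<sigma>] by (auto simp: crit_pt_def)

lemma crit_pt_unique: "\<sigma> \<in> labels \<Longrightarrow> near \<sigma> u \<Longrightarrow> crit u \<Longrightarrow> u = crit_pt \<sigma>"
  using ex1_crit_near [of \<sigma>] crit_pt [of \<sigma>] by blast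

lemma inj_on_crit_pt: "inj_on crit_pt labels"
  by (rule inj_onI) (metis crit_pt(1) near_label_unique)

lemma crit_eq_image: "{u. crit u} = crit_pt ` labels"
proof
  show "{u. crit u} \<subseteq> crit_pt ` labels"
  proof
    fix u assume "u \<in> {u. crit u}"
    then have u: "crit u" by simp
    then obtain \<sigma> where "\<sigma> \<in> labels" "near \<sigma> u" by (rule crit_near_label)
    with u show "u \<in> crit_pt ` labels" using crit_pt_unique by blast
  qed
qed (use crit_pt(2) in blast)

text \<open>In a coordinate with nonzero label the quadratic coefficient is at least 0.7 and the
  cubic term costs at most 0.22 of the square, so a displacement gains 2/5 of its square, far more
  than the coupling takes. Coordinates with label 0 are frozen, since the potential is concave along
  them.\<close>

lemma pot_crit_le:
  assumes z: "crit z" "near \<sigma> z" and \<sigma>: "\<sigma> \<in> labels"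
    and h: "\<And>i. \<bar>h $ i\<bar> \<le> 1 / 5" "\<And>i. \<sigma> $ i = 0 \<Longrightarrow> h $ i = 0"
  shows "pot z \<le> pot (z + h)"
proof -
  have "2 / 5 * (h $ i)\<^sup>2 \<le> - force z i * h $ i + (3 * (z $ i)\<^sup>2 - 1) / 2 * (h $ i)\<^sup>2
     + z $ i * (h $ i) ^ 3 + (h $ i) ^ 4 / 4" for i
  proof (cases "\<sigma> $ i = 0")
    case False
    have "\<bar>z $ i - \<sigma> $ i\<bar> \<le> 1 / 10" "\<sigma> $ i \<in> {-1, 0, 1}"
      using z(2) \<sigma> by (auto simp: near_def labels_def)
    with False have zi: "9 / 10 \<le> \<bar>z $ i\<bar>" "\<bar>z $ i\<bar> \<le> 11 / 10"
      using near_sign_bounds [of "z $ i" "\<sigma> $ i"] by auto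
    have "9 / 10 * (9 / 10) \<le> \<bar>z $ i\<bar> * \<bar>z $ i\<bar>"
      using zi by (intro mult_mono) auto
    then have z2: "81 / 100 \<le> (z $ i)\<^sup>2" by (simp add: power2_eq_square)
    have "\<bar>z $ i * h $ i\<bar> \<le> 11 / 10 * (1 / 5)"
      unfolding abs_mult using zi h(1) by (intro mult_mono) auto
    then have "- 22 / 100 \<le> z $ i * h $ i" by simp
    moreover have "7 / 10 \<le> (3 * (z $ i)\<^sup>2 - 1) / 2" "0 \<le> (h $ i)\<^sup>2 / 4"
      using z2 by simp_all
    ultimately have "2 / 5 \<le> (3 * (z $ i)\<^sup>2 - 1) / 2 + z $ i * h $ i + (h $ i)\<^sup>2 / 4"
      by linarith
    then have "2 / 5 * (h $ i)\<^sup>2 \<le> ((3 * (z $ i)\<^sup>2 - 1) / 2 + z $ i * h $ i + (h $ i)\<^sup>2 / 4) * (h $ i)\<^sup>2"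
      by (rule mult_right_mono) simp
    also have "\<dots> = - force z i * h $ i + (3 * (z $ i)\<^sup>2 - 1) / 2 * (h $ i)\<^sup>2
     + z $ i * (h $ i) ^ 3 + (h $ i) ^ 4 / 4"
      using z(1) by (simp add: crit_def power2_eq_square power3_eq_cube power4_eq_xxxx algebra_simps)
    finally show ?thesis .
  qed (simp add: h(2))
  then have "(\<Sum>i\<in>UNIV. 2 / 5 * (h $ i)\<^sup>2) \<le> (\<Sum>i\<in>UNIV. - force z i * h $ i
     + (3 * (z $ i)\<^sup>2 - 1) / 2 * (h $ i)\<^sup>2 + z $ i * (h $ i) ^ 3 + (h $ i) ^ 4 / 4)"
    by (intro sum_mono)
  moreover have "(\<Sum>i\<in>UNIV. 2 / 5 * (h $ i)\<^sup>2) = 2 / 5 * (norm h)\<^sup>2"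
    by (simp add: norm_sq_eq_sum sum_distrib_left)
  moreover have "\<epsilon> * (h \<bullet> (S *v h)) \<le> (norm h)\<^sup>2 / 400000"
    using abs_quadratic_le [OF component_le_norm_cart, of h] by simp
  ultimately show ?thesis
    unfolding pot_expand [of z h] using zero_le_power2 [of "norm h"] by linarith
qed

text \<open>The zero diagonal of \<open>S\<close> removes the coupling from the second-order term,
  so along an axis it enters through \<open>force\<close> alone.\<close>

lemma pot_axis_expand:
  "pot (u + d *\<^sub>R axis i 1) = pot u - force u i * d + (3 * (u $ i)\<^sup>2 - 1) / 2 * d\<^sup>2 + u $ i * d ^ 3 + d ^ 4 / 4"
proof -
  have "axis i 1 \<bullet> (S *v axis i 1) = 0"
    by (simp add: inner_axis' matrix_vector_mul_component inner_axis diag)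
  moreover have "(\<Sum>j\<in>UNIV. - force u j * (d *\<^sub>R axis i 1) $ j
      + (3 * (u $ j)\<^sup>2 - 1) / 2 * ((d *\<^sub>R axis i 1) $ j)\<^sup>2
      + u $ j * ((d *\<^sub>R axis i 1) $ j) ^ 3 + ((d *\<^sub>R axis i 1) $ j) ^ 4 / 4)
    = (\<Sum>j\<in>{i}. - force u j * d + (3 * (u $ j)\<^sup>2 - 1) / 2 * d\<^sup>2 + u $ j * d ^ 3 + d ^ 4 / 4)"
    by (rule sum.mono_neutral_cong_right) (auto simp: axis_def)
  ultimately show ?thesis
    unfolding pot_expand by (simp add: matrix_vector_mult_scaleR)
qed

lemma pot_axis_neg:
  assumes "\<bar>u $ i\<bar> \<le> 1 / 10" "\<bar>d\<bar> \<le> 1 / 5" "d \<noteq> 0" "force u i = 0"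
  shows "pot (u + d *\<^sub>R axis i 1) < pot u"
proof -
  have "\<bar>u $ i * u $ i\<bar> \<le> 1 / 10 * (1 / 10)" "\<bar>u $ i * d\<bar> \<le> 1 / 10 * (1 / 5)" "\<bar>d * d\<bar> \<le> 1 / 5 * (1 / 5)"
    unfolding abs_mult using assms by (intro mult_mono; simp)+
  then have "(3 * (u $ i)\<^sup>2 - 1) / 2 + u $ i * d + d\<^sup>2 / 4 < 0"
    unfolding power2_eq_square abs_le_iff by (simp add: field_simps)
  then have "((3 * (u $ i)\<^sup>2 - 1) / 2 + u $ i * d + d\<^sup>2 / 4) * d\<^sup>2 < 0"
    using assms(3) by (simp add: mult_neg_pos)
  then show ?thesis
    unfolding pot_axis_expand using assms(4)
    by (simp add: power2_eq_square power3_eq_cube power4_eq_xxxx algebra_simps)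
qed

text \<open>Near the saddle the potential is least there in the coordinates other than
  \<open>i\<close>. So the saddle is compared with \<open>p\<close>, which has exact signs in those
  coordinates and the saddle's own coordinate \<open>i\<close>: only well \<open>i\<close>
  contributes, at most its barrier height 1/4.\<close>

lemma pot_one_zero_le:
  assumes \<sigma>: "one_zero \<sigma> i"
  shows "pot (crit_pt \<sigma>) \<le> - (real CARD('n) - 1) / 4 + 1 / 400000"
proof -
  define z where "z = crit_pt \<sigma>"
  have z: "crit z" "near \<sigma> z"
    using crit_pt one_zero_label [OF \<sigma>] by (auto simp: z_def)
  define p where "p = (\<chi> j. if j = i then z $ i else \<sigma> $ j)"
  have zi: "\<bar>z $ j - \<sigma> $ j\<bar> \<le> 1 / 10" for j using z(2) by (simp add: near_def)
  have zi0: "\<bar>z $ i\<bar> \<le> 1 / 10" using zi [of i] \<sigma> by (simp add: one_zero_def)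
  have "pot z \<le> pot (z + (p - z))"
  proof (rule pot_crit_le [OF z one_zero_label [OF \<sigma>]])
    show "\<bar>(p - z) $ j\<bar> \<le> 1 / 5" for j
      using zi [of j] by (auto simp: p_def abs_minus_commute)
    show "\<sigma> $ j = 0 \<Longrightarrow> (p - z) $ j = 0" for j
      using \<sigma> by (auto simp: one_zero_def p_def)
  qed
  also have "z + (p - z) = p" by simp
  also have "pot p \<le> - (real CARD('n) - 1) / 4 + 1 / 400000"
  proof -
    have sq: "((p $ j)\<^sup>2 - 1)\<^sup>2 / 4 \<le> (if j = i then 1 / 4 else 0)" for j
    proof (cases "j = i")
      case True
      have "\<bar>(z $ i)\<^sup>2\<bar> \<le> 1" "0 \<le> (z $ i)\<^sup>2"
        using zi0 by (simp_all add: abs_square_le_1)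
      then have "\<bar>(z $ i)\<^sup>2 - 1\<bar> \<le> 1" by linarith
      then have "((z $ i)\<^sup>2 - 1)\<^sup>2 \<le> 1" by (simp add: abs_square_le_1)
      then show ?thesis by (simp add: True p_def)
    next
      case False
      then have "\<sigma> $ j \<in> {-1, 1}" using \<sigma> by (simp add: one_zero_def)
      with False show ?thesis by (auto simp: p_def)
    qed
    have "(\<Sum>j\<in>UNIV. ((p $ j)\<^sup>2 - 1)\<^sup>2 / 4) \<le> (\<Sum>j\<in>UNIV. if j = i then 1 / 4 else 0)"
      by (rule sum_mono) (rule sq)
    then have "(\<Sum>j\<in>UNIV. ((p $ j)\<^sup>2 - 1)\<^sup>2 / 4) \<le> 1 / 4" by simp
    moreover have "\<bar>p $ j\<bar> \<le> 1" for j
    proof (cases "j = i")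
      case False
      then have "\<sigma> $ j \<in> {-1, 1}" using \<sigma> by (simp add: one_zero_def)
      with False show ?thesis by (auto simp: p_def)
    qed (use zi0 in \<open>simp add: p_def\<close>)
    then have "\<bar>\<epsilon> * (p \<bullet> (S *v p))\<bar> \<le> 1\<^sup>2 / 400000"
      by (rule abs_quadratic_le)
    ultimately show ?thesis
      unfolding pot_eq by (simp add: field_simps)
  qed
  finally show ?thesis by (simp add: z_def)
qed

text \<open>A minimax argument: from a point of the surface \<open>force u i = 0\<close>, moving along axis \<open>i\<close> lowers
  the potential by concavity, and the remaining coordinates are in a convex bowl around the saddle.\<close>

lemma force_nonzero_below_saddles:
  assumes n: "CARD('n) \<ge> 2"
    and below: "\<And>\<sigma> i. one_zero \<sigma> i \<Longrightarrow> c < pot (crit_pt \<sigma>)"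
    and u: "pot u \<le> c" "\<bar>u $ i\<bar> \<le> 3 / 5"
  shows "force u i \<noteq> 0"
proof
  assume f: "force u i = 0"
  have "one_zero (\<chi> j. if j = i then 0 else 1) i" by (simp add: one_zero_def)
  from below [OF this] pot_one_zero_le [OF this]
  have c: "c \<le> - (real CARD('n) - 1) / 4 + 1 / 400000" by linarith
  moreover have "1 / 4 \<le> (real CARD('n) - 1) / 4" using n by simp
  ultimately have "pot u \<le> 0" using u(1) by linarith
  note bounds = pot_nonpos_bounds [OF this]
  \<comment> \<open>A bootstrap: the small cubic puts \<open>u $ i\<close> near 0, its other roots
    being excluded by the bound 3/5; then \<open>1 - (u $ i)^2\<close> is at least 0.99, which
    improves 1/10 to 2/100000.\<close>
  have fi: "\<bar>u $ i - (u $ i) ^ 3\<bar> \<le> 1 / 100000"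
    using f bounds(1) [of i] unfolding force_def by linarith
  then have "\<bar>u $ i - (u $ i) ^ 3\<bar> \<le> 1 / 10000" by linarith
  from near_cubic_root [OF this] have ui: "\<bar>u $ i\<bar> \<le> 1 / 10"
    using u(2) by linarith
  have "\<bar>u $ i * u $ i\<bar> \<le> 1 / 10 * (1 / 10)"
    unfolding abs_mult using ui by (intro mult_mono) auto
  then have "99 / 100 \<le> \<bar>1 - u $ i * u $ i\<bar>" by simp
  then have "\<bar>u $ i\<bar> * (99 / 100) \<le> \<bar>u $ i\<bar> * \<bar>1 - u $ i * u $ i\<bar>"
    by (rule mult_left_mono) simp
  also have "\<dots> = \<bar>u $ i - (u $ i) ^ 3\<bar>"
    by (simp add: abs_mult [symmetric] power3_eq_cube algebra_simps)
  finally have ui2: "\<bar>u $ i\<bar> \<le> 2 / 100000" using fi by linarith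
  have uu: "\<bar>u $ i * u $ i\<bar> \<le> 2 / 100000 * (2 / 100000)"
    unfolding abs_mult using ui2 by (intro mult_mono) auto
  then have qi: "1 - 1 / 100000 \<le> ((u $ i)\<^sup>2 - 1)\<^sup>2"
  proof -
    have "1 - 2 * (u $ i)\<^sup>2 \<le> ((u $ i)\<^sup>2 - 1)\<^sup>2"
      by (simp add: power2_diff)
    with uu show ?thesis by (simp add: power2_eq_square)
  qed
  have Q: "(\<Sum>k\<in>UNIV. ((u $ k)\<^sup>2 - 1)\<^sup>2 / 4) \<le> 1 / 4 + 1 / 100000"
    using u(1) c bounds(2) unfolding pot_eq by (simp add: field_simps)
  \<comment> \<open>Coordinate \<open>i\<close> alone uses nearly all of the energy 1/4, so every
    other coordinate is forced close to 1 or -1.\<close>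
  have uj: "\<bar>\<bar>u $ j\<bar> - 1\<bar> \<le> 1 / 100" if "j \<noteq> i" for j
  proof -
    have "(\<Sum>k\<in>{i, j}. ((u $ k)\<^sup>2 - 1)\<^sup>2 / 4) \<le> (\<Sum>k\<in>UNIV. ((u $ k)\<^sup>2 - 1)\<^sup>2 / 4)"
      by (rule sum_mono2) auto
    with Q qi that have "((u $ j)\<^sup>2 - 1)\<^sup>2 \<le> (1 / 100)\<^sup>2"
      by (simp add: power2_eq_square [of "1 / 100"])
    then have "\<bar>(u $ j)\<^sup>2 - 1\<bar> \<le> \<bar>1 / 100\<bar>"
      by (simp only: abs_le_square_iff)
    then have "\<bar>(u $ j)\<^sup>2 - 1\<bar> \<le> 1 / 100" by simp
    moreover have "(u $ j)\<^sup>2 - 1 = (\<bar>u $ j\<bar> - 1) * (\<bar>u $ j\<bar> + 1)"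
      by (simp add: power2_eq_square algebra_simps)
    moreover have "\<bar>\<bar>u $ j\<bar> - 1\<bar> * 1 \<le> \<bar>\<bar>u $ j\<bar> - 1\<bar> * \<bar>\<bar>u $ j\<bar> + 1\<bar>"
      by (intro mult_left_mono) auto
    ultimately show ?thesis by (simp add: abs_mult)
  qed
  define \<sigma> :: "real ^ 'n" where "\<sigma> = (\<chi> j. if j = i then 0 else if u $ j > 0 then 1 else -1)"
  have \<sigma>: "one_zero \<sigma> i" by (simp add: \<sigma>_def one_zero_def)
  define z where "z = crit_pt \<sigma>"
  have z: "crit z" "near \<sigma> z"
    using crit_pt one_zero_label [OF \<sigma>] by (auto simp: z_def)
  have zj: "\<bar>z $ j - \<sigma> $ j\<bar> \<le> 1 / 10" for j using z(2) by (simp add: near_def)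
  have zi0: "\<bar>z $ i\<bar> \<le> 1 / 10" using zj [of i] by (simp add: \<sigma>_def)
  define d where "d = z $ i - u $ i"
  define v where "v = u + d *\<^sub>R axis i 1"
  have "\<bar>d\<bar> \<le> 1 / 5" using zi0 ui unfolding d_def by linarith
  then have "pot v \<le> pot u"
    using pot_axis_neg [OF ui, of d] f by (cases "d = 0") (auto simp: v_def)
  moreover have "pot z \<le> pot (z + (v - z))"
  proof (rule pot_crit_le [OF z one_zero_label [OF \<sigma>]])
    have vi: "v $ i = z $ i" by (simp add: v_def d_def)
    show "\<bar>(v - z) $ j\<bar> \<le> 1 / 5" for j
    proof (cases "j = i")
      case False
      then have "v $ j = u $ j" by (simp add: v_def axis_def)
      then show ?thesis
        using uj [OF False] zj [of j] False by (auto simp: \<sigma>_def abs_if split: if_splits)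
    qed (simp add: vi)
    show "\<sigma> $ j = 0 \<Longrightarrow> (v - z) $ j = 0" for j
      using vi by (auto simp: \<sigma>_def split: if_splits)
  qed
  ultimately show False
    using below [OF \<sigma>] u(1) by (simp add: z_def)
qed

text \<open>On exact signs the wells vanish and \<open>pot\<close> is a constant plus \<epsilon>
  times the Ising energy. The critical point differs from its sign vector by O(\<epsilon>), so after
  division by \<epsilon> the energies are off by O(\<epsilon>) only.\<close>

lemma ising_le_of_pot_le:
  assumes \<sigma>: "\<sigma> \<in> sign_vectors" and w: "w \<in> sign_vectors" and le: "pot (crit_pt \<sigma>) \<le> pot w"
  shows "ising_energy S \<sigma> \<le> ising_energy S w + 2 * \<epsilon> * (coupling_sum S)\<^sup>2"
proof -
  let ?L = "coupling_sum S"
  have \<sigma>l: "\<sigma> \<in> labels" using \<sigma> sign_vectors_subset_labels by blast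
  define z where "z = crit_pt \<sigma>"
  have z: "crit z" "near \<sigma> z" using crit_pt [OF \<sigma>l] by (auto simp: z_def)
  have zj: "\<bar>z $ j - \<sigma> $ j\<bar> \<le> 1 / 10" and \<sigma>j: "\<sigma> $ j = -1 \<or> \<sigma> $ j = 1" for j
    using z(2) \<sigma> by (auto simp: near_def sign_vectors_def)
  have zb: "9 / 10 \<le> \<bar>z $ j\<bar>" "\<bar>z $ j\<bar> \<le> 11 / 10" for j using near_sign_bounds [OF zj \<sigma>j, of j] by auto
  \<comment> \<open>As \<open>\<sigma> $ j\<close> has square 1, the cubic factors as
    \<open>z (z - \<sigma>) (z + \<sigma>)\<close>; here \<open>z (z + \<sigma>)\<close> is at least
    1.71 in modulus, so the coupling controls the distance to the sign.\<close>
  have close: "\<bar>z $ j - \<sigma> $ j\<bar> \<le> \<epsilon> * ?L" for j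
  proof -
    have "\<bar>\<epsilon> * (S *v z) $ j\<bar> \<le> \<epsilon> * (?L * (11 / 10))"
      using abs_mult_vec_le [OF zb(2), of S j] eps_pos by (simp add: abs_mult)
    moreover have "\<epsilon> * (S *v z) $ j = (z $ j - \<sigma> $ j) * (z $ j * (z $ j + \<sigma> $ j))"
      using z(1) \<sigma>j [of j] unfolding crit_def force_def
      by (auto simp: power3_eq_cube algebra_simps dest: spec [of _ j])
    ultimately have "\<bar>z $ j - \<sigma> $ j\<bar> * (\<bar>z $ j\<bar> * \<bar>z $ j + \<sigma> $ j\<bar>) \<le> 11 / 10 * (\<epsilon> * ?L)"
      by (simp add: abs_mult mult_ac)
    moreover have "9 / 10 * (19 / 10) \<le> \<bar>z $ j\<bar> * \<bar>z $ j + \<sigma> $ j\<bar>"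
      using zb zj [of j] \<sigma>j [of j] by (intro mult_mono) (auto simp: abs_if split: if_splits)
    then have "\<bar>z $ j - \<sigma> $ j\<bar> * (11 / 10) \<le> \<bar>z $ j - \<sigma> $ j\<bar> * (\<bar>z $ j\<bar> * \<bar>z $ j + \<sigma> $ j\<bar>)"
      by (intro mult_left_mono) auto
    ultimately have "\<bar>z $ j - \<sigma> $ j\<bar> * (11 / 10) \<le> 11 / 10 * (\<epsilon> * ?L)"
      by (rule order_trans [rotated])
    then show ?thesis by simp
  qed
  have "pot w = - CARD('n) / 4 + \<epsilon> * ising_energy S w"
  proof -
    have "((w $ j)\<^sup>2 - 1)\<^sup>2 / 4 = 0" for j
      using w by (auto simp: sign_vectors_def dest: spec [of _ j])
    then show ?thesis by (simp add: pot_eq ising_energy_def)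
  qed
  moreover have "- real CARD('n) / 4 + \<epsilon> * (- 1 / 2 * (z \<bullet> (S *v z))) \<le> pot z"
    unfolding pot_eq by (simp add: sum_nonneg)
  ultimately have "\<epsilon> * (- 1 / 2 * (z \<bullet> (S *v z))) \<le> \<epsilon> * ising_energy S w"
    using le unfolding z_def by linarith
  then have 1: "- 1 / 2 * (z \<bullet> (S *v z)) \<le> ising_energy S w"
    using eps_pos by (rule mult_left_le_imp_le)
  have "(z - \<sigma>) \<bullet> (S *v (z + \<sigma>)) = z \<bullet> (S *v z) - \<sigma> \<bullet> (S *v \<sigma>)"
    using symmetric_inner_swap [OF sym, of z \<sigma>]
    by (simp add: matrix_vector_right_distrib inner_add_right inner_diff_left)
  moreover have "\<bar>(z - \<sigma>) \<bullet> (S *v (z + \<sigma>))\<bar> \<le> ?L * (\<epsilon> * ?L) * 3"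
  proof (rule abs_bilinear_le)
    show "\<bar>(z - \<sigma>) $ j\<bar> \<le> \<epsilon> * ?L" for j using close [of j] by simp
    show "\<bar>(z + \<sigma>) $ j\<bar> \<le> 3" for j using zb(2) [of j] \<sigma>j [of j] by auto
  qed
  ultimately have "z \<bullet> (S *v z) - \<sigma> \<bullet> (S *v \<sigma>) \<le> 3 * (\<epsilon> * (?L * ?L))"
    by (simp add: mult_ac)
  moreover have "0 \<le> \<epsilon> * (?L * ?L)" using eps_pos by simp
  ultimately show ?thesis
    using 1 by (simp add: ising_energy_def power2_eq_square)
qed

end

section \<open>Orbits below the saddle energy\<close>

lemma abs_diff_le_of_deriv_bound:
  fixes f :: "real \<Rightarrow> real"
  assumes "a \<le> b" "\<And>t. (f has_real_derivative f' t) (at t)"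
    and "\<And>t. a \<le> t \<Longrightarrow> t \<le> b \<Longrightarrow> \<bar>f' t\<bar> \<le> B"
  shows "\<bar>f b - f a\<bar> \<le> B * (b - a)"
proof (cases "a = b")
  case False
  with assms(1) have "a < b" by simp
  from MVT2 [OF this assms(2)] obtain t where t: "a < t" "t < b" "f b - f a = (b - a) * f' t"
    by blast
  then have "\<bar>f b - f a\<bar> = (b - a) * \<bar>f' t\<bar>" by (simp add: abs_mult)
  also have "\<dots> \<le> (b - a) * B" using t assms(3) by (intro mult_left_mono) auto
  finally show ?thesis by (simp add: mult.commute)
qed simp

lemma diff_ge_of_deriv_ge:
  fixes f :: "real \<Rightarrow> real"
  assumes "a < b" "\<And>t. (f has_real_derivative f' t) (at t)"
    and "\<And>t. a \<le> t \<Longrightarrow> t \<le> b \<Longrightarrow> m \<le> f' t"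
  shows "m * (b - a) \<le> f b - f a"
proof -
  from MVT2 [OF assms(1,2)] obtain t where t: "a < t" "t < b" "f b - f a = (b - a) * f' t"
    by blast
  then have "(b - a) * m \<le> f b - f a" using assms(3) [of t] by (simp add: mult_left_mono)
  then show ?thesis by (simp add: mult.commute)
qed

text \<open>The slope is positive somewhere before \<open>s\<close> and cannot decrease, so it is
  still positive after \<open>s\<close>.\<close>

lemma no_interior_peak_of_convex:
  fixes f :: "real \<Rightarrow> real"
  assumes "a < s" "s < b"
    and f: "\<And>t. (f has_real_derivative f' t) (at t)" "\<And>t. (f' has_real_derivative f'' t) (at t)"
    and conv: "\<And>t. a \<le> t \<Longrightarrow> t \<le> b \<Longrightarrow> 0 \<le> f'' t"
    and "f a < f s"
  shows "f s < f b"
proof -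
  from MVT2 [OF assms(1) f(1)] obtain t where t: "a < t" "t < s" "f s - f a = (s - a) * f' t"
    by blast
  from MVT2 [OF assms(2) f(1)] obtain t' where t': "s < t'" "t' < b" "f b - f s = (b - s) * f' t'"
    by blast
  have "0 < f' t" using t \<open>f a < f s\<close> assms(1) zero_less_mult_pos [of "s - a" "f' t"] by simp
  moreover have "0 * (t' - t) \<le> f' t' - f' t"
    using t t' conv by (intro diff_ge_of_deriv_ge [OF _ f(2)]) auto
  ultimately have "0 < f' t'" by simp
  then have "0 < (b - s) * f' t'" using assms(2) by simp
  with t' show ?thesis by simp
qed

text \<open>The slope increases strictly, so it is nonzero at some time. From there the growth is at
  least linear, forward in time for a positive slope and backward for a negative one; this is why
  all real times matter.\<close>

lemma unbounded_of_second_deriv_pos: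
  fixes f :: "real \<Rightarrow> real"
  assumes f: "\<And>t. (f has_real_derivative f' t) (at t)" "\<And>t. (f' has_real_derivative f'' t) (at t)"
    and pos: "\<And>t. 0 < f'' t" and bdd: "\<And>t. \<bar>f t\<bar> \<le> B"
  shows False
proof -
  have mono: "f' s \<le> f' t" if "s \<le> t" for s t
    using diff_ge_of_deriv_ge [OF _ f(2), of s t 0] pos that
    by (cases "s = t") (auto intro: less_imp_le)
  from MVT2 [OF zero_less_one f(2)] have "f' 1 \<noteq> f' 0"
    using pos by (metis diff_0_right eq_iff_diff_eq_0 mult_1 order_less_irrefl)
  then obtain s where s: "f' s \<noteq> 0" by metis
  have "0 \<le> B" using bdd [of 0] by linarith
  define d where "d = (2 * B + 1) / \<bar>f' s\<bar>"
  have d: "0 < d" "d * \<bar>f' s\<bar> = 2 * B + 1" using s \<open>0 \<le> B\<close> by (simp_all add: d_def)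
  consider "0 < f' s" | "f' s < 0" using s by linarith
  then show False
  proof cases
    case 1
    have "f' s * (s + d - s) \<le> f (s + d) - f s"
      using d mono by (intro diff_ge_of_deriv_ge [OF _ f(1)]) auto
    with 1 d bdd [of s] bdd [of "s + d"] show False by (simp add: mult.commute)
  next
    case 2
    have "- f' s * (s - (s - d)) \<le> - f s - - f (s - d)"
      using d mono by (intro diff_ge_of_deriv_ge [OF _ DERIV_minus [OF f(1)]]) auto
    with 2 d bdd [of s] bdd [of "s - d"] show False by (simp add: mult.commute)
  qed
qed

lemma continuous_nonzero_constant_sign:
  fixes f :: "real \<Rightarrow> real"
  assumes "continuous_on UNIV f" "\<And>t. f t \<noteq> 0"
  shows "(\<forall>t. 0 < f t) \<or> (\<forall>t. f t < 0)"
proof (rule ccontr)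
  assume "\<not> ?thesis"
  then obtain s t where "f s \<le> 0" "0 \<le> f t" by (auto simp: not_less)
  moreover have "connected (range f)"
    using assms(1) by (intro connected_continuous_image) auto
  ultimately have "0 \<in> range f"
    by (meson connectedD_interval rangeI)
  with assms(2) show False by force
qed

locale low_energy_orbit = weak_coupling S \<epsilon>
  for S :: "real ^ 'n ^ 'n" and \<epsilon> :: real +
  fixes u w :: "real \<Rightarrow> real ^ 'n" and c :: real
  assumes two_le_card: "2 \<le> CARD('n)"
    and below_saddles: "\<And>\<sigma> i. one_zero \<sigma> i \<Longrightarrow> c < pot (crit_pt \<sigma>)"
    and deriv_u: "\<And>t i. ((\<lambda>t. u t $ i) has_real_derivative w t $ i) (at t)"
    and deriv_w: "\<And>t i. ((\<lambda>t. w t $ i) has_real_derivative force (u t) i) (at t)"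
    and energy: "\<And>t. (\<Sum>i\<in>UNIV. (w t $ i)\<^sup>2 / 2) + pot (u t) = c"
begin

section \<open>A priori bounds and confinement to one well\<close>

lemma pot_le: "pot (u t) \<le> c"
  using energy [of t] sum_nonneg [of UNIV "\<lambda>i. (w t $ i)\<^sup>2 / 2"] by simp

lemma c_le: "c \<le> - (real CARD('n) - 1) / 4 + 1 / 400000"
proof -
  have "one_zero (\<chi> j. if j = i then 0 else 1) i" for i :: 'n by (simp add: one_zero_def)
  from below_saddles [OF this [of undefined]] pot_one_zero_le [OF this [of undefined]] show ?thesis by linarith
qed

lemma pot_nonpos: "pot (u t) \<le> 0"
proof -
  have "1 / 4 \<le> (real CARD('n) - 1) / 4" using two_le_card by simp
  with pot_le [of t] c_le show ?thesis by linarith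
qed

lemmas coupling_bound = pot_nonpos_bounds [OF pot_nonpos]

lemma force_nonzero: "\<bar>u t $ i\<bar> \<le> 3 / 5 \<Longrightarrow> force (u t) i \<noteq> 0"
  using force_nonzero_below_saddles [OF two_le_card below_saddles pot_le] .

lemma continuous_u: "continuous_on UNIV (\<lambda>t. u t $ i)"
  by (intro DERIV_continuous_on) (use deriv_u in \<open>simp add: has_field_derivative_at_within\<close>)

lemma continuous_coupling: "continuous_on UNIV (\<lambda>t. (S *v u t) $ i)"
  unfolding matrix_vector_mult_def by (simp, intro continuous_intros continuous_u)

text \<open>The force also changes sign near 1 and -1, so the coordinate is first clamped to
  [-1/2, 1/2]. The clamped force never vanishes: inside by \<open>force_nonzero\<close>, at the ends
  because 1/2 - 1/8 outweighs the coupling. Yet it has opposite signs at the two ends.\<close>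

lemma no_sign_change: "\<not> (1 / 2 \<le> u s $ i \<and> u t $ i \<le> - 1 / 2)"
proof
  assume st: "1 / 2 \<le> u s $ i \<and> u t $ i \<le> - 1 / 2"
  define k where "k r = max (- 1 / 2) (min (1 / 2) (u r $ i))" for r
  define f where "f r = k r - (k r) ^ 3 + \<epsilon> * (S *v u r) $ i" for r
  have "f r \<noteq> 0" for r
  proof
    assume "f r = 0"
    then have "\<bar>k r - (k r) ^ 3\<bar> \<le> 1 / 10000"
      using coupling_bound(1) [of r i] unfolding f_def by linarith
    from near_cubic_root [OF this] have "\<bar>k r\<bar> \<le> 1 / 10"
      by (auto simp: k_def)
    then have "k r = u r $ i" by (auto simp: k_def)
    with \<open>f r = 0\<close> \<open>\<bar>k r\<bar> \<le> 1 / 10\<close> force_nonzero [of r i] show False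
      by (simp add: f_def force_def)
  qed
  moreover have "continuous_on UNIV f"
    unfolding f_def k_def by (intro continuous_intros continuous_u continuous_coupling)
  ultimately have "(\<forall>t. 0 < f t) \<or> (\<forall>t. f t < 0)"
    by (intro continuous_nonzero_constant_sign)
  moreover have "0 < f s"
  proof -
    have ks: "k s = 1 / 2" using st by (simp add: k_def)
    have "(1 / 2 :: real) ^ 3 = 1 / 8" by (simp add: power3_eq_cube)
    then show ?thesis using coupling_bound(1) [of s i] unfolding f_def ks by linarith
  qed
  moreover have "f t < 0"
  proof -
    have kt: "k t = - 1 / 2" using st by (simp add: k_def)
    have "(- 1 / 2 :: real) ^ 3 = - 1 / 8" by (simp add: power3_eq_cube)
    then show ?thesis using coupling_bound(1) [of t i] unfolding f_def kt by linarith
  qed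
  ultimately show False by (meson less_asym)
qed

section \<open>Energy balance of single coordinates\<close>

definition mode :: "'n \<Rightarrow> real \<Rightarrow> real" where
  "mode k t = (w t $ k)\<^sup>2 / 2 + ((u t $ k)\<^sup>2 - 1)\<^sup>2 / 4"

text \<open>Below the saddles, the energy above the well bottoms is at most one barrier height 1/4
  plus the coupling; as no \<open>mode\<close> is negative, this bounds every partial sum.\<close>

lemma sum_mode_le: "(\<Sum>k\<in>A. mode k t) \<le> 1 / 4 + 1 / 100000"
proof -
  have "(\<Sum>k\<in>A. mode k t) \<le> (\<Sum>k\<in>UNIV. mode k t)"
    by (rule sum_mono2) (auto simp: mode_def)
  also have "\<dots> = c + CARD('n) / 4 + \<epsilon> / 2 * (u t \<bullet> (S *v u t))"
    using energy [of t] by (simp add: mode_def sum.distrib pot_eq)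
  also have "\<dots> \<le> 1 / 4 + 1 / 100000"
    using c_le coupling_bound(2) [of t] by (simp add: field_simps)
  finally show ?thesis .
qed

lemma mode_le: "mode k t \<le> 1 / 4 + 1 / 100000"
  using sum_mode_le [of t "{k}"] by simp

lemma abs_u_le: "\<bar>u t $ k\<bar> \<le> 3 / 2"
proof (rule ccontr)
  assume "\<not> ?thesis"
  then have "3 / 2 * (3 / 2) \<le> \<bar>u t $ k\<bar> * \<bar>u t $ k\<bar>" by (intro mult_mono) auto
  then have "5 / 4 \<le> (u t $ k)\<^sup>2 - 1" by (simp add: power2_eq_square)
  then have "5 / 4 * (5 / 4) \<le> ((u t $ k)\<^sup>2 - 1) * ((u t $ k)\<^sup>2 - 1)" by (intro mult_mono) auto
  then have "25 / 16 \<le> ((u t $ k)\<^sup>2 - 1)\<^sup>2" by (simp add: power2_eq_square)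
  then have "25 / 64 \<le> mode k t"
    using zero_le_power2 [of "w t $ k"] unfolding mode_def by linarith
  with mode_le [of k t] show False by simp
qed

lemma abs_w_le: "\<bar>w t $ k\<bar> \<le> 1"
proof -
  have "(w t $ k)\<^sup>2 / 2 \<le> mode k t" by (simp add: mode_def)
  with mode_le [of k t] show ?thesis by (simp add: abs_square_le_1 [symmetric])
qed

text \<open>A decoupled oscillator conserves its \<open>mode\<close>; the derivative is the power of
  the coupling alone.\<close>

lemma mode_drift:
  assumes "s \<le> t"
  shows "\<bar>mode k t - mode k s\<bar> \<le> 1 / 100000 * (t - s)"
proof (rule abs_diff_le_of_deriv_bound [OF assms])
  show "(mode k has_real_derivative w t $ k * (\<epsilon> * (S *v u t) $ k)) (at t)" for t
  proof -
    have "((\<lambda>t. (w t $ k)\<^sup>2 / 2 + ((u t $ k)\<^sup>2 - 1)\<^sup>2 / 4) has_real_derivative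
        w t $ k * (\<epsilon> * (S *v u t) $ k)) (at t)"
      by (rule derivative_eq_intros deriv_u deriv_w refl | simp)+
        (simp add: force_def power2_eq_square power3_eq_cube algebra_simps)
    then show ?thesis by (simp add: mode_def [abs_def])
  qed
  show "\<bar>w t $ k * (\<epsilon> * (S *v u t) $ k)\<bar> \<le> 1 / 100000" for t
    using mult_mono [OF abs_w_le [of t k] coupling_bound(1) [of t k]] by (simp add: abs_mult)
qed

text \<open>The radius 579/1000 is slightly above \<open>1 / sqrt 3\<close>, beyond which the diagonal of the Hessian is
  positive.\<close>

definition bad :: "'n \<Rightarrow> real \<Rightarrow> bool" where
  "bad k t \<longleftrightarrow> \<bar>u t $ k\<bar> \<le> 579 / 1000"

lemma closed_bad: "closed {t. bad k t}"
  unfolding bad_def by (intro closed_Collect_le continuous_intros continuous_u)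

lemma bad_sq: "bad k t \<Longrightarrow> (u t $ k)\<^sup>2 \<le> 335241 / 1000000"
proof -
  assume "bad k t"
  then have "\<bar>u t $ k\<bar> * \<bar>u t $ k\<bar> \<le> 579 / 1000 * (579 / 1000)"
    unfolding bad_def by (intro mult_mono) auto
  then show ?thesis by (simp add: power2_eq_square)
qed

text \<open>The constant is \<open>(1 - 0.579^2)^2 / 4\<close> rounded down, the potential energy at
  the edge of the bad region.\<close>

lemma bad_mode: "bad k t \<Longrightarrow> (w t $ k)\<^sup>2 / 2 + 110476 / 1000000 \<le> mode k t"
proof -
  assume "bad k t"
  then have "664759 / 1000000 \<le> 1 - (u t $ k)\<^sup>2" using bad_sq by simp
  then have "664759 / 1000000 * (664759 / 1000000) \<le> (1 - (u t $ k)\<^sup>2) * (1 - (u t $ k)\<^sup>2)"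
    by (intro mult_mono) auto
  also have "\<dots> = ((u t $ k)\<^sup>2 - 1)\<^sup>2" by (simp add: power2_eq_square algebra_simps)
  finally show ?thesis by (simp add: mode_def)
qed

text \<open>0.13955 is what one of two bad coordinates can have after the other has taken 0.110476,
  with drift included. So little energy keeps the coordinate off the top of the barrier, where its
  acceleration would be small.\<close>

lemma sq_ge_of_mode_le:
  assumes "mode k t \<le> 13955 / 100000"
  shows "2528 / 10000 \<le> (u t $ k)\<^sup>2"
proof (rule ccontr)
  assume "\<not> ?thesis"
  then have "7472 / 10000 \<le> 1 - (u t $ k)\<^sup>2" by simp
  then have "7472 / 10000 * (7472 / 10000) \<le> (1 - (u t $ k)\<^sup>2) * (1 - (u t $ k)\<^sup>2)"
    by (intro mult_mono) auto
  also have "\<dots> = ((u t $ k)\<^sup>2 - 1)\<^sup>2" by (simp add: power2_eq_square algebra_simps)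
  finally have "13957 / 100000 \<le> mode k t"
    using zero_le_power2 [of "w t $ k"] unfolding mode_def by linarith
  with assms show False by simp
qed

text \<open>The square is followed because it treats both wells alike and is convex in time while it
  stays away from 0 and 1.\<close>

lemma deriv_sq: "((\<lambda>t. (u t $ k)\<^sup>2) has_real_derivative 2 * u t $ k * w t $ k) (at t)"
  by (rule derivative_eq_intros deriv_u refl | simp)+

lemma deriv2_sq: "((\<lambda>t. 2 * u t $ k * w t $ k) has_real_derivative
    2 * (w t $ k)\<^sup>2 + 2 * ((u t $ k)\<^sup>2 * (1 - (u t $ k)\<^sup>2)) + 2 * (u t $ k * (\<epsilon> * (S *v u t) $ k))) (at t)"
  by (rule derivative_eq_intros deriv_u deriv_w refl | simp)+
    (simp add: force_def power2_eq_square power3_eq_cube algebra_simps)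

lemma deriv2_sq_ge:
  "2 * ((u t $ k)\<^sup>2 * (1 - (u t $ k)\<^sup>2)) - 3 / 100000 \<le>
    2 * (w t $ k)\<^sup>2 + 2 * ((u t $ k)\<^sup>2 * (1 - (u t $ k)\<^sup>2)) + 2 * (u t $ k * (\<epsilon> * (S *v u t) $ k))"
proof -
  have "\<bar>u t $ k * (\<epsilon> * (S *v u t) $ k)\<bar> \<le> 3 / 2 * (1 / 100000)"
    unfolding abs_mult [of "u t $ k"] by (intro mult_mono abs_u_le coupling_bound(1)) auto
  then show ?thesis using zero_le_power2 [of "w t $ k"] by linarith
qed

lemma not_always_bad: "\<exists>t. \<not> bad i t"
proof (rule ccontr)
  assume "\<not> ?thesis"
  then have b: "\<bar>u t $ i\<bar> \<le> 579 / 1000" for t by (simp add: bad_def)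
  have "force (u t) i \<noteq> 0" for t using b [of t] by (intro force_nonzero) simp
  moreover have "continuous_on UNIV (\<lambda>t. force (u t) i)"
    unfolding force_def by (intro continuous_intros continuous_u continuous_coupling)
  ultimately have "(\<forall>t. 0 < force (u t) i) \<or> (\<forall>t. force (u t) i < 0)"
    by (intro continuous_nonzero_constant_sign)
  then show False
  proof
    assume "\<forall>t. 0 < force (u t) i"
    then show False using unbounded_of_second_deriv_pos [OF deriv_u deriv_w _ b] by blast
  next
    assume "\<forall>t. force (u t) i < 0"
    moreover have "\<bar>- u t $ i\<bar> \<le> 579 / 1000" for t using b by simp
    ultimately show False
      using unbounded_of_second_deriv_pos [OF DERIV_minus [OF deriv_u] DERIV_minus [OF deriv_w], of i]
      by fastforce
  qed
qed

text \<open>When bad coordinate \<open>i\<close> becomes good at time \<open>t0\<close>, another coordinate \<open>j\<close> must be bad at \<open>t0\<close>, so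
  both modes share the energy. Their total is so small that \<open>i\<close> stays good for a time 3/2 while \<open>j\<close>
  cannot stay bad that long.\<close>

lemma switch_impossible:
  assumes always: "\<And>t. \<exists>k. bad k t" and t': "t0 < t'"
    and i0: "bad i t0" and leave: "\<And>t. t0 < t \<Longrightarrow> t \<le> t' \<Longrightarrow> \<not> bad i t"
  shows False
proof -
  \<comment> \<open>At every time shortly after \<open>t0\<close> some other coordinate is bad; a
    finite union of closed sets is closed, so this holds at \<open>t0\<close> too.\<close>
  define C where "C = (\<Union>k\<in>-{i}. {t. bad k t})"
  have "{t0<..t'} \<subseteq> C"
    using always leave unfolding C_def by force
  moreover have "closed C" unfolding C_def by (intro closed_UN ballI closed_bad) auto
  ultimately have "closure {t0<..t'} \<subseteq> C" by (rule closure_minimal)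
  then have "t0 \<in> C" using t' by auto
  then obtain j where ji: "j \<noteq> i" and j0: "bad j t0" by (auto simp: C_def)
  let ?T = "t0 + 3 / 2"
  have mij: "110476 / 1000000 \<le> mode i t0" "110476 / 1000000 \<le> mode j t0"
    using bad_mode [OF i0] bad_mode [OF j0] zero_le_power2 [of "w t0 $ i"] zero_le_power2 [of "w t0 $ j"]
    by linarith+
  have drift: "mode k t \<le> mode k t0 + 3 / 200000" if "t0 \<le> t" "t \<le> ?T" for k t
  proof -
    have "1 / 100000 * (t - t0) \<le> 1 / 100000 * (3 / 2)"
      using that by (intro mult_left_mono) auto
    with mode_drift [OF that(1), of k] show ?thesis by linarith
  qed
  have "mode i t0 + mode j t0 \<le> 1 / 4 + 1 / 100000"
    using sum_mode_le [of t0 "{i, j}"] ji by simp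
  then have m: "mode k t \<le> 13955 / 100000" if "k \<in> {i, j}" "t0 \<le> t" "t \<le> ?T" for k t
    using that(1) drift [OF that(2,3), of k] mij by auto
  \<comment> \<open>Three bad coordinates would cost more than 0.33, beyond the total of about
    1/4.\<close>
  have others: "\<not> bad k t" if "k \<noteq> i" "k \<noteq> j" "t0 \<le> t" "t \<le> ?T" for k t
  proof
    assume "bad k t"
    then have "110476 / 1000000 \<le> mode k t"
      using bad_mode [of k t] zero_le_power2 [of "w t $ k"] by linarith
    moreover have "mode i t0 + mode j t0 + mode k t0 \<le> 1 / 4 + 1 / 100000"
      using sum_mode_le [of t0 "{i, j, k}"] ji that by (simp add: ac_simps)
    ultimately show False
      using drift [OF that(3,4), of k] mij by linarith
  qed
  have i_good: "\<not> bad i t1" if t1: "t0 < t1" "t1 \<le> ?T" for t1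
  proof
    assume i1: "bad i t1"
    then have "t' < t1" using leave t1 by force
    have speed: "\<bar>w t $ i\<bar> \<le> 53 / 100" if "t0 \<le> t" "t \<le> t1" for t
    proof (rule ccontr)
      assume "\<not> ?thesis"
      then have "53 / 100 * (53 / 100) \<le> \<bar>w t $ i\<bar> * \<bar>w t $ i\<bar>" by (intro mult_mono) auto
      moreover have "(w t $ i)\<^sup>2 / 2 \<le> mode i t" by (simp add: mode_def)
      ultimately show False using m [of i t] that t1 by (simp add: power2_eq_square)
    qed
    \<comment> \<open>While the square is at most 0.98 it is convex, and having risen after
      \<open>t0\<close> it could not come back. So \<open>i\<close> must first go out almost to the
      bottom of a well.\<close>
    have "\<exists>t. t0 \<le> t \<and> t \<le> t1 \<and> 98 / 100 < (u t $ i)\<^sup>2"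
    proof (rule ccontr)
      assume "\<not> ?thesis"
      then have le: "(u t $ i)\<^sup>2 \<le> 98 / 100" if "t0 \<le> t" "t \<le> t1" for t using that by force
      have "(u t' $ i)\<^sup>2 < (u t1 $ i)\<^sup>2"
      proof (rule no_interior_peak_of_convex [OF \<open>t0 < t'\<close> \<open>t' < t1\<close> deriv_sq deriv2_sq])
        fix t assume t: "t0 \<le> t" "t \<le> t1"
        have "2528 / 10000 * (2 / 100) \<le> (u t $ i)\<^sup>2 * (1 - (u t $ i)\<^sup>2)"
          using sq_ge_of_mode_le [OF m, of i t] le [OF t] t t1 by (intro mult_mono) auto
        then show "0 \<le> 2 * (w t $ i)\<^sup>2 + 2 * ((u t $ i)\<^sup>2 * (1 - (u t $ i)\<^sup>2)) + 2 * (u t $ i * (\<epsilon> * (S *v u t) $ i))"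
          using deriv2_sq_ge [of t i] by linarith
      next
        have "\<bar>u t0 $ i\<bar> < \<bar>u t' $ i\<bar>"
          using i0 leave [of t'] t' by (simp add: bad_def)
        then show "(u t0 $ i)\<^sup>2 < (u t' $ i)\<^sup>2"
          using power_strict_mono [of "\<bar>u t0 $ i\<bar>" "\<bar>u t' $ i\<bar>" 2] by simp
      qed
      moreover have "\<bar>u t1 $ i\<bar> \<le> \<bar>u t' $ i\<bar>"
        using i1 leave [of t'] t' by (simp add: bad_def)
      then have "(u t1 $ i)\<^sup>2 \<le> (u t' $ i)\<^sup>2" by (simp add: abs_le_square_iff)
      ultimately show False by simp
    qed
    then obtain ts where ts: "t0 \<le> ts" "ts \<le> t1" "98 / 100 < (u ts $ i)\<^sup>2" by blast
    have "989 / 1000 < \<bar>u ts $ i\<bar>"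
    proof (rule ccontr)
      assume "\<not> ?thesis"
      then have "\<bar>u ts $ i\<bar> * \<bar>u ts $ i\<bar> \<le> 989 / 1000 * (989 / 1000)" by (intro mult_mono) auto
      with ts show False by (simp add: power2_eq_square)
    qed
    \<comment> \<open>From 0.579 to 0.989 the distance is 0.41; out and back at speed at most 0.53
      takes longer than 3/2.\<close>
    moreover have "\<bar>u ts $ i - u t0 $ i\<bar> \<le> 53 / 100 * (ts - t0)"
      using ts speed by (intro abs_diff_le_of_deriv_bound [OF _ deriv_u]) auto
    moreover have "\<bar>u t1 $ i - u ts $ i\<bar> \<le> 53 / 100 * (t1 - ts)"
      using ts speed by (intro abs_diff_le_of_deriv_bound [OF _ deriv_u]) auto
    ultimately have "41 / 100 \<le> 53 / 100 * (ts - t0)" "41 / 100 \<le> 53 / 100 * (t1 - ts)"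
      using i0 i1 unfolding bad_def by linarith+
    then show False using t1 by (simp add: field_simps)
  qed
  have j_bad: "bad j t" if "t0 \<le> t" "t \<le> ?T" for t
    using always [of t] others i_good j0 that by (metis order_le_less)
  \<comment> \<open>A bound on the velocity of the square of coordinate \<open>j\<close>: the
    position is bounded by \<open>bad_sq\<close>, the kinetic energy by 0.13955 - 0.110476 =
    0.029074, and 0.058148 is twice that.\<close>
  have "p' \<le> 2793 / 10000" if "t0 \<le> t" "t \<le> ?T" and p': "p' = \<bar>2 * u t $ j * w t $ j\<bar>" for t p'
  proof (rule ccontr)
    assume "\<not> ?thesis"
    then have "2793 / 10000 * (2793 / 10000) \<le> \<bar>2 * u t $ j * w t $ j\<bar> * \<bar>2 * u t $ j * w t $ j\<bar>"
      unfolding p' by (intro mult_mono) auto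
    also have "\<dots> = 4 * ((u t $ j)\<^sup>2 * (w t $ j)\<^sup>2)"
      by (simp add: power2_eq_square)
    also have "\<dots> \<le> 4 * (335241 / 1000000 * (58148 / 1000000))"
      using bad_sq [OF j_bad] bad_mode [OF j_bad] m [of j t] that by (intro mult_mono mult_left_mono) force+
    finally show False by simp
  qed
  from this [of t0] this [of ?T]
  have "\<bar>2 * u t0 $ j * w t0 $ j\<bar> \<le> 2793 / 10000" "\<bar>2 * u ?T $ j * w ?T $ j\<bar> \<le> 2793 / 10000"
    by auto
  \<comment> \<open>The velocity of the square would gain 0.5655 in time 3/2, but its bound allows a
    change of 2 * 0.2793 = 0.5586 only.\<close>
  moreover have "377 / 1000 * (?T - t0) \<le> 2 * u ?T $ j * w ?T $ j - 2 * u t0 $ j * w t0 $ j"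
  proof (rule diff_ge_of_deriv_ge [OF _ deriv2_sq])
    fix t assume t: "t0 \<le> t" "t \<le> ?T"
    \<comment> \<open>By concavity, \<open>s (1 - s)\<close> is at least its value at 0.2528 for
      \<open>s\<close> between 0.2528 and 1 - 0.2528.\<close>
    have "0 \<le> ((u t $ j)\<^sup>2 - 2528 / 10000) * (7472 / 10000 - (u t $ j)\<^sup>2)"
      using sq_ge_of_mode_le [OF m, of j t] bad_sq [OF j_bad [OF t]] t by (intro mult_nonneg_nonneg) auto
    then have "2528 / 10000 * (7472 / 10000) \<le> (u t $ j)\<^sup>2 * (1 - (u t $ j)\<^sup>2)"
      by (simp add: algebra_simps)
    then show "377 / 1000 \<le> 2 * (w t $ j)\<^sup>2 + 2 * ((u t $ j)\<^sup>2 * (1 - (u t $ j)\<^sup>2)) + 2 * (u t $ j * (\<epsilon> * (S *v u t) $ j))"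
      using deriv2_sq_ge [of t j] by linarith
  qed simp
  moreover have "377 / 1000 * (?T - t0) = 1131 / 2000" by simp
  ultimately show False unfolding abs_le_iff by linarith
qed

text \<open>Bad times form a closed set, so there is a last one before \<open>t\<close>, and it is a
  switch of the kind already excluded.\<close>

lemma recover_forward_impossible:
  assumes always: "\<And>t. \<exists>k. bad k t" and "bad i s" "s < t" "\<not> bad i t"
  shows False
proof -
  let ?K = "{s..t} \<inter> {r. bad i r}"
  have "compact ?K" by (intro compact_Int_closed closed_bad) simp
  moreover have "s \<in> ?K" using assms by simp
  ultimately obtain t0 where t0: "t0 \<in> ?K" "\<forall>r\<in>?K. r \<le> t0"
    using compact_attains_sup [of ?K] by blast
  have "t0 < t" using t0 assms(4) by (cases "t0 = t") auto
  moreover have "\<not> bad i r" if "t0 < r" "r \<le> t" for r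
  proof
    assume "bad i r"
    with t0 that have "r \<in> ?K" by auto
    with t0(2) have "r \<le> t0" by (rule bspec)
    with that show False by simp
  qed
  ultimately show False
    using switch_impossible [OF always, of t0 t i] t0 by auto
qed

text \<open>Reversibility carries the exclusion of forward recovery over to the past, for a
  coordinate whose good time precedes its bad time.\<close>

lemma reversed: "low_energy_orbit S \<epsilon> (\<lambda>t. u (- t)) (\<lambda>t. - w (- t)) c"
proof
  show "((\<lambda>t. u (- t) $ i) has_real_derivative (- w (- t)) $ i) (at t)" for t i
    using DERIV_chain' [OF DERIV_minus [OF DERIV_ident [of "at t"]] deriv_u [of i "- t"]] by simp
  show "((\<lambda>t. (- w (- t)) $ i) has_real_derivative force (u (- t)) i) (at t)" for t i
    using DERIV_minus [OF DERIV_chain' [OF DERIV_minus [OF DERIV_ident [of "at t"]] deriv_w [of i "- t"]]] by simp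
qed (use two_le_card below_saddles energy in auto)

lemma exists_all_good: "\<exists>t. \<forall>k. 579 / 1000 < \<bar>u t $ k\<bar>"
proof (rule ccontr)
  assume "\<not> ?thesis"
  then have always: "\<exists>k. bad k t" for t
    unfolding bad_def by (meson not_less)
  interpret rev: low_energy_orbit S \<epsilon> "\<lambda>t. u (- t)" "\<lambda>t. - w (- t)" c
    by (rule reversed)
  obtain i where i: "bad i 0" using always by blast
  obtain t where t: "\<not> bad i t" using not_always_bad by blast
  consider "0 < t" | "t < 0" using i t by (cases t "0 :: real" rule: linorder_cases) auto
  then show False
  proof cases
    case 1
    then show False using recover_forward_impossible [OF always i _ t] by simp
  next
    case 2
    have "rev.bad k r \<longleftrightarrow> bad k (- r)" for k r by (simp add: rev.bad_def bad_def)
    then show False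
      using rev.recover_forward_impossible [of i 0 "- t"] always i t 2 by simp
  qed
qed

end

section \<open>The original scale\<close>

definition gradient :: "real \<Rightarrow> real \<Rightarrow> real ^ 'n ^ 'n \<Rightarrow> real ^ 'n \<Rightarrow> 'n \<Rightarrow> real" where
  "gradient \<alpha> \<beta> S x i = (x $ i) ^ 3 + (\<beta> - \<alpha>\<^sup>2) * x $ i - (S *v x) $ i"

lemma has_derivative_potential:
  fixes S :: "real ^ 'n ^ 'n"
  assumes sym: "transpose S = S"
  shows "(potential \<alpha> \<beta> S has_derivative (\<lambda>h. \<Sum>i\<in>UNIV. gradient \<alpha> \<beta> S x i * h $ i)) (at x)"
proof -
  have nth: "((\<lambda>x. x $ i) has_derivative (\<lambda>h. h $ i)) (at x)" for i
    by (rule bounded_linear_imp_has_derivative) auto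
  have S: "((*v) S has_derivative (*v) S) (at x)"
    by (rule bounded_linear_imp_has_derivative) (rule matrix_vector_mul_bounded_linear)
  have 1: "((\<lambda>x. \<Sum>i\<in>UNIV. 1 / 4 * (x $ i) ^ 4) has_derivative (\<lambda>h. \<Sum>i\<in>UNIV. (x $ i) ^ 3 * h $ i)) (at x)"
    by (rule has_derivative_sum) (rule derivative_eq_intros nth refl | simp add: mult_ac)+
  have 2: "((\<lambda>x. (\<beta> - \<alpha>\<^sup>2) / 2 * (x \<bullet> x)) has_derivative (\<lambda>h. (\<beta> - \<alpha>\<^sup>2) * (x \<bullet> h))) (at x)"
    by (rule derivative_eq_intros refl | simp add: inner_commute)+
  have 3: "((\<lambda>x. 1 / 2 * (x \<bullet> (S *v x))) has_derivative (\<lambda>h. (S *v x) \<bullet> h)) (at x)"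
    by (rule derivative_eq_intros S refl | simp)+
      (simp add: symmetric_inner_swap [OF sym, of x] inner_commute)
  have "(\<lambda>h. \<Sum>i\<in>UNIV. gradient \<alpha> \<beta> S x i * h $ i) =
      (\<lambda>h. (\<Sum>i\<in>UNIV. (x $ i) ^ 3 * h $ i) + (\<beta> - \<alpha>\<^sup>2) * (x \<bullet> h) - (S *v x) \<bullet> h)"
    by (simp add: gradient_def inner_vec_def sum_distrib_left sum.distrib [symmetric]
        sum_subtractf [symmetric] algebra_simps)
  with has_derivative_diff [OF has_derivative_add [OF 1 2] 3] show ?thesis
    by (simp add: potential_def [abs_def])
qed

lemma critical_points_potential:
  fixes S :: "real ^ 'n ^ 'n"
  assumes sym: "transpose S = S"
  shows "critical_points (potential \<alpha> \<beta> S) = {x. \<forall>i. gradient \<alpha> \<beta> S x i = 0}"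
proof (intro set_eqI iffI)
  fix x assume "x \<in> critical_points (potential \<alpha> \<beta> S)"
  then have "(\<lambda>h. \<Sum>i\<in>UNIV. gradient \<alpha> \<beta> S x i * h $ i) = (\<lambda>h. 0)"
    using has_derivative_unique [OF has_derivative_potential [OF sym]]
    by (simp add: critical_points_def)
  then have "(\<Sum>j\<in>UNIV. gradient \<alpha> \<beta> S x j * (axis i 1 :: real ^ 'n) $ j) = 0" for i
    by (rule fun_cong)
  then show "x \<in> {x. \<forall>i. gradient \<alpha> \<beta> S x i = 0}"
    by (simp add: axis_def if_distrib [where f = "\<lambda>t. _ * t"] cong: if_cong)
next
  fix x assume "x \<in> {x. \<forall>i. gradient \<alpha> \<beta> S x i = 0}"
  then show "x \<in> critical_points (potential \<alpha> \<beta> S)"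
    using has_derivative_potential [OF sym, of \<alpha> \<beta> x] by (simp add: critical_points_def)
qed

lemma partial_deriv_potential:
  fixes S :: "real ^ 'n ^ 'n"
  assumes sym: "transpose S = S"
  shows "partial_deriv j (potential \<alpha> \<beta> S) = (\<lambda>x. gradient \<alpha> \<beta> S x j)"
proof
  fix x
  show "partial_deriv j (potential \<alpha> \<beta> S) x = gradient \<alpha> \<beta> S x j"
    unfolding partial_deriv_def frechet_derivative_at [OF has_derivative_potential [OF sym], symmetric]
    by (simp add: axis_def if_distrib [where f = "\<lambda>t. _ * t"] cong: if_cong)
qed

lemma hessian_potential:
  fixes S :: "real ^ 'n ^ 'n"
  assumes sym: "transpose S = S"
  shows "hessian (potential \<alpha> \<beta> S) x $ i $ j = (if i = j then 3 * (x $ i)\<^sup>2 + (\<beta> - \<alpha>\<^sup>2) else 0) - S $ i $ j"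
proof -
  have nth: "((\<lambda>x. x $ j) has_derivative (\<lambda>h. h $ j)) (at x)"
    by (rule bounded_linear_imp_has_derivative) auto
  have S: "((\<lambda>x. (S *v x) $ j) has_derivative (\<lambda>h. (S *v h) $ j)) (at x)"
    by (rule bounded_linear_imp_has_derivative)
      (rule bounded_linear_compose [OF bounded_linear_vec_nth matrix_vector_mul_bounded_linear])
  have "((\<lambda>x. gradient \<alpha> \<beta> S x j) has_derivative
      (\<lambda>h. (3 * (x $ j)\<^sup>2 + (\<beta> - \<alpha>\<^sup>2)) * h $ j - (S *v h) $ j)) (at x)"
    unfolding gradient_def
    by (rule derivative_eq_intros nth S refl | simp add: algebra_simps)+
  then have "hessian (potential \<alpha> \<beta> S) x $ i $ j =
      (3 * (x $ j)\<^sup>2 + (\<beta> - \<alpha>\<^sup>2)) * axis i 1 $ j - (S *v axis i 1) $ j"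
    unfolding hessian_def partial_deriv_potential [OF sym]
    by (simp add: partial_deriv_def frechet_derivative_at [symmetric])
  also have "(S *v axis i 1) $ j = S $ j $ i"
    by (simp add: matrix_vector_mul_component inner_axis)
  also have "\<dots> = S $ i $ j"
    using sym by (metis transpose_def vec_lambda_beta)
  finally show ?thesis by (simp add: axis_def)
qed

lemma transpose_hessian_potential:
  fixes S :: "real ^ 'n ^ 'n"
  assumes "transpose S = S"
  shows "transpose (hessian (potential \<alpha> \<beta> S) x) = hessian (potential \<alpha> \<beta> S) x"
proof -
  have "S $ i $ j = S $ j $ i" for i j
    using assms by (metis transpose_def vec_lambda_beta)
  then show ?thesis
    by (simp add: vec_eq_iff transpose_def hessian_potential [OF assms])
qed

lemma inner_hessian_potential:
  fixes S :: "real ^ 'n ^ 'n"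
  assumes "transpose S = S"
  shows "h \<bullet> (hessian (potential \<alpha> \<beta> S) x *v h) =
    (\<Sum>i\<in>UNIV. (3 * (x $ i)\<^sup>2 + (\<beta> - \<alpha>\<^sup>2)) * (h $ i)\<^sup>2) - h \<bullet> (S *v h)"
proof -
  have "(hessian (potential \<alpha> \<beta> S) x *v h) $ i =
      (3 * (x $ i)\<^sup>2 + (\<beta> - \<alpha>\<^sup>2)) * h $ i - (S *v h) $ i" for i
    by (simp add: matrix_vector_mult_def hessian_potential [OF assms] left_diff_distrib sum_subtractf
        if_distrib [where f = "\<lambda>t. t * _"] cong: if_cong)
  then show ?thesis
    by (simp add: inner_vec_def right_diff_distrib sum_subtractf power2_eq_square mult_ac)
qed

locale scaled_potential = weak_coupling S \<epsilon>
  for S :: "real ^ 'n ^ 'n" and \<epsilon> :: real +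
  fixes \<alpha> \<beta> a :: real
  assumes a_pos: "0 < a" and a_sq: "a\<^sup>2 = \<alpha>\<^sup>2 - \<beta>" and eps_eq: "\<epsilon> = 1 / a\<^sup>2"
begin

abbreviation U :: "real ^ 'n \<Rightarrow> real" where
  "U \<equiv> potential \<alpha> \<beta> S"

abbreviation P :: "real ^ 'n \<Rightarrow> real ^ 'n" where
  "P \<sigma> \<equiv> a *\<^sub>R crit_pt \<sigma>"

lemma beta_alpha: "\<beta> - \<alpha>\<^sup>2 = - (a\<^sup>2)"
  using a_sq by simp

lemma unscale:
  fixes x :: "real ^ 'n"
  obtains u where "x = a *\<^sub>R u"
proof
  show "x = a *\<^sub>R (x /\<^sub>R a)" using a_pos by simp
qed

lemma gradient_scale: "gradient \<alpha> \<beta> S (a *\<^sub>R u) i = - (a ^ 3) * force u i"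
proof -
  have "a ^ 3 * (\<epsilon> * (S *v u) $ i) = a * (S *v u) $ i"
    using a_pos by (simp add: eps_eq power2_eq_square power3_eq_cube)
  then show ?thesis
    unfolding gradient_def force_def beta_alpha
    by (simp add: matrix_vector_mult_scaleR power2_eq_square power3_eq_cube algebra_simps)
qed

lemma U_scale: "U (a *\<^sub>R u) = a ^ 4 * pot u"
proof -
  have "(\<Sum>i\<in>UNIV. 1 / 4 * ((a *\<^sub>R u) $ i) ^ 4) + (\<beta> - \<alpha>\<^sup>2) / 2 * ((a *\<^sub>R u) \<bullet> (a *\<^sub>R u))
      = a ^ 4 * (\<Sum>i\<in>UNIV. (u $ i) ^ 4 / 4 - (u $ i)\<^sup>2 / 2)"
    unfolding beta_alpha inner_vec_def sum_distrib_left sum.distrib [symmetric]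
    by (intro sum.cong refl) (simp add: field_simps power2_eq_square power4_eq_xxxx)
  moreover have "1 / 2 * ((a *\<^sub>R u) \<bullet> (S *v (a *\<^sub>R u))) = a ^ 4 * (\<epsilon> / 2 * (u \<bullet> (S *v u)))"
    using a_pos by (simp add: eps_eq matrix_vector_mult_scaleR power2_eq_square power4_eq_xxxx)
  ultimately show ?thesis
    by (simp only: potential_def pot_def right_diff_distrib)
qed

section \<open>Critical points and minima of the original potential\<close>

lemma critical_points_U: "critical_points U = P ` labels"
proof -
  have "a *\<^sub>R u \<in> critical_points U \<longleftrightarrow> crit u" for u
    using a_pos by (simp add: critical_points_potential [OF sym] gradient_scale crit_def)
  then have "critical_points U = (\<lambda>u. a *\<^sub>R u) ` {u. crit u}"
    by (auto simp: image_iff) (metis unscale)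
  then show ?thesis by (simp add: crit_eq_image image_image)
qed

lemma P_critical: "\<sigma> \<in> labels \<Longrightarrow> P \<sigma> \<in> critical_points U"
  unfolding critical_points_U by (rule imageI)

lemma inj_on_P: "inj_on P labels"
  using inj_on_crit_pt a_pos by (auto simp: inj_on_def)

lemma card_critical_points_U: "card (critical_points U) = 3 ^ CARD('n)"
  by (simp add: critical_points_U card_image inj_on_P card_labels)

lemma near_crit_pt: "\<sigma> \<in> labels \<Longrightarrow> \<bar>crit_pt \<sigma> $ i - \<sigma> $ i\<bar> \<le> 1 / 10"
  using crit_pt(1) by (simp add: near_def)

lemma local_min_P:
  assumes "\<sigma> \<in> sign_vectors"
  shows "P \<sigma> \<in> local_min_points U"
proof -
  have \<sigma>: "\<sigma> \<in> labels" using assms sign_vectors_subset_labels by blast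
  have "U (P \<sigma>) \<le> U y" if "dist y (P \<sigma>) < a / 5" for y
  proof -
    obtain v where v: "y = a *\<^sub>R v" by (rule unscale)
    define h where "h = v - crit_pt \<sigma>"
    have "dist y (P \<sigma>) = a * norm h"
      using a_pos by (simp add: dist_norm v h_def scaleR_right_diff_distrib [symmetric])
    then have "norm h < 1 / 5" using that a_pos by simp
    then have "\<bar>h $ i\<bar> \<le> 1 / 5" for i using component_le_norm_cart [of h i] by linarith
    moreover have "\<sigma> $ i = 0 \<Longrightarrow> h $ i = 0" for i
      using assms by (auto simp: sign_vectors_def dest: spec [of _ i])
    ultimately have "pot (crit_pt \<sigma>) \<le> pot (crit_pt \<sigma> + h)"
      using pot_crit_le [OF crit_pt(2) [OF \<sigma>] crit_pt(1) [OF \<sigma>] \<sigma>] by blast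
    then show ?thesis using a_pos by (simp add: v U_scale h_def)
  qed
  then show ?thesis
    unfolding local_min_points_def eventually_nhds_metric using a_pos
    by (auto intro!: exI [of _ "a / 5"])
qed

lemma local_min_points_U: "local_min_points U = P ` sign_vectors"
proof
  show "local_min_points U \<subseteq> P ` sign_vectors"
  proof
    fix x assume "x \<in> local_min_points U"
    then have ev: "\<forall>\<^sub>F y in nhds x. U x \<le> U y" by (simp add: local_min_points_def)
    then have "\<forall>\<^sub>F y in at x. U x \<le> U y"
      by (simp add: eventually_nhds_conv_at)
    then have "x \<in> critical_points U"
      using has_derivative_local_min [OF has_derivative_potential [OF sym]]
        has_derivative_potential [OF sym, of \<alpha> \<beta> x] by (simp add: critical_points_def)
    then obtain \<sigma> where \<sigma>: "\<sigma> \<in> labels" and x: "x = P \<sigma>"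
      by (auto simp: critical_points_U)
    have "\<sigma> $ i \<noteq> 0" for i
    proof
      assume "\<sigma> $ i = 0"
      then have zi: "\<bar>crit_pt \<sigma> $ i\<bar> \<le> 1 / 10" using near_crit_pt [OF \<sigma>, of i] by simp
      obtain e where e: "0 < e" "\<And>y. dist y x < e \<Longrightarrow> U x \<le> U y"
        using ev unfolding eventually_nhds_metric by blast
      \<comment> \<open>1/5 is the range of \<open>pot_axis_neg\<close>, and
        \<open>e / (2 * a)\<close> keeps the rescaled step inside the ball of radius
        \<open>e\<close>.\<close>
      define d where "d = min (1 / 5) (e / (2 * a))"
      have d: "0 < d" "\<bar>d\<bar> \<le> 1 / 5" "d \<le> e / (2 * a)" using e a_pos by (auto simp: d_def)
      let ?y = "a *\<^sub>R (crit_pt \<sigma> + d *\<^sub>R axis i 1)"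
      have "dist ?y x = a * d"
        using a_pos d by (simp add: x dist_norm scaleR_right_distrib norm_axis_1)
      also have "\<dots> < e" using d(3) e a_pos by (simp add: field_simps)
      finally have "U x \<le> U ?y" by (rule e)
      then have "pot (crit_pt \<sigma>) \<le> pot (crit_pt \<sigma> + d *\<^sub>R axis i 1)"
        using a_pos by (simp add: x U_scale)
      moreover have "force (crit_pt \<sigma>) i = 0" using crit_pt(2) [OF \<sigma>] by (simp add: crit_def)
      ultimately show False using pot_axis_neg [OF zi d(2)] d(1) by simp
    qed
    then have "\<sigma> \<in> sign_vectors"
      using \<sigma> by (auto simp: labels_def sign_vectors_def)
    with x show "x \<in> P ` sign_vectors" by blast
  qed
qed (use local_min_P in blast)

lemma card_local_min_points_U: "card (local_min_points U) = 2 ^ CARD('n)"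
  unfolding local_min_points_U
  by (simp add: card_image inj_on_subset [OF inj_on_P sign_vectors_subset_labels] card_sign_vectors)

lemma signum_P:
  assumes "\<sigma> \<in> sign_vectors"
  shows "signum_vec (P \<sigma>) = \<sigma>"
proof -
  have "sgn (a * crit_pt \<sigma> $ i) = \<sigma> $ i" for i
  proof -
    have "\<bar>crit_pt \<sigma> $ i - \<sigma> $ i\<bar> \<le> 1 / 10"
      using assms sign_vectors_subset_labels by (intro near_crit_pt) blast
    moreover have "\<sigma> $ i = -1 \<or> \<sigma> $ i = 1" using assms by (auto simp: sign_vectors_def)
    ultimately have "sgn (crit_pt \<sigma> $ i) = \<sigma> $ i" by (auto simp: sgn_if abs_if split: if_splits)
    then show ?thesis using a_pos by (simp add: sgn_mult)
  qed
  then show ?thesis by (simp add: signum_vec_def vec_eq_iff)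
qed

lemma signum_local_min_points_U: "signum_vec ` local_min_points U = sign_vectors"
  by (auto simp: local_min_points_U image_image signum_P)

text \<open>Comparing the minimum with the test points \<open>a *\<^sub>R w\<close> bounds its Ising
  energy up to an error that is smaller than the gap between distinct energy values.\<close>

lemma global_min_signum:
  assumes gap: "\<And>v w. v \<in> sign_vectors \<Longrightarrow> w \<in> sign_vectors \<Longrightarrow> ising_energy S w < ising_energy S v \<Longrightarrow>
      ising_energy S w + 2 * \<epsilon> * (coupling_sum S)\<^sup>2 < ising_energy S v"
    and x: "x \<in> global_min_points U"
  shows "is_arg_min (ising_energy S) (\<lambda>v. v \<in> sign_vectors) (signum_vec x)"
proof -
  have "x \<in> local_min_points U"
    using x by (simp add: local_min_points_def global_min_points_def)
  then obtain \<sigma> where \<sigma>: "\<sigma> \<in> sign_vectors" "x = P \<sigma>" by (auto simp: local_min_points_U)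
  have "\<not> ising_energy S w < ising_energy S \<sigma>" if w: "w \<in> sign_vectors" for w
  proof -
    have "U x \<le> U (a *\<^sub>R w)" using x by (simp add: global_min_points_def)
    then have "pot (crit_pt \<sigma>) \<le> pot w" using a_pos by (simp add: \<sigma>(2) U_scale)
    from ising_le_of_pot_le [OF \<sigma>(1) w this] gap [OF \<sigma>(1) w] show ?thesis by linarith
  qed
  then show ?thesis
    using \<sigma> by (auto simp: is_arg_min_def signum_P)
qed

text \<open>The diagonal Hessian entry is negative at \<open>i\<close> and positive at any other
  coordinate. For n = 1 there is no other one, and the point would be a maximum.\<close>

lemma min_saddle_value_le:
  assumes n: "2 \<le> CARD('n)" and \<sigma>: "one_zero \<sigma> i"
  shows "min_saddle_value U \<le> a ^ 4 * pot (crit_pt \<sigma>)"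
proof -
  have \<sigma>l: "\<sigma> \<in> labels" using one_zero_label [OF \<sigma>] .
  obtain j where j: "j \<noteq> i"
  proof -
    have "UNIV \<noteq> {i}"
    proof
      assume "UNIV = {i}"
      then have "CARD('n) = card {i}" by simp
      with n show False by simp
    qed
    then show ?thesis using that by blast
  qed
  have hess: "hessian U (P \<sigma>) $ k $ k = a\<^sup>2 * (3 * (crit_pt \<sigma> $ k)\<^sup>2 - 1)" for k
    by (simp add: hessian_potential [OF sym] beta_alpha diag power_mult_distrib algebra_simps)
  have "\<bar>crit_pt \<sigma> $ i\<bar> \<le> 1 / 10"
    using near_crit_pt [OF \<sigma>l, of i] \<sigma> by (simp add: one_zero_def)
  then have "\<bar>crit_pt \<sigma> $ i\<bar> * \<bar>crit_pt \<sigma> $ i\<bar> \<le> 1 / 10 * (1 / 10)"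
    by (intro mult_mono) auto
  then have neg: "hessian U (P \<sigma>) $ i $ i < 0"
    using a_pos by (simp add: hess mult_pos_neg power2_eq_square)
  have "9 / 10 \<le> \<bar>crit_pt \<sigma> $ j\<bar>"
    using near_sign_bounds(1) [OF near_crit_pt [OF \<sigma>l, of j]] \<sigma> j by (auto simp: one_zero_def)
  then have "9 / 10 * (9 / 10) \<le> \<bar>crit_pt \<sigma> $ j\<bar> * \<bar>crit_pt \<sigma> $ j\<bar>"
    by (intro mult_mono) auto
  then have pos: "0 < hessian U (P \<sigma>) $ j $ j"
    using a_pos by (simp add: hess power2_eq_square)
  have "P \<sigma> \<in> saddle_points U"
    using morse_index_strictly_between [OF transpose_hessian_potential [OF sym] neg pos] P_critical [OF \<sigma>l]
    by (simp add: saddle_points_def)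
  moreover have "finite (critical_points U)"
    by (rule card_ge_0_finite) (simp add: card_critical_points_U)
  then have "finite (saddle_points U)"
    by (rule finite_subset [rotated]) (auto simp: saddle_points_def)
  ultimately have "min_saddle_value U \<le> U (P \<sigma>)"
    unfolding min_saddle_value_def by (intro Min_le) auto
  then show ?thesis by (simp add: U_scale)
qed

text \<open>Time and space are rescaled by \<open>a\<close> each, so velocities by \<open>a\<^sup>2\<close> and energies by \<open>a\<^sup>4\<close>.\<close>

lemma low_energy_orbit_of_solution:
  assumes n: "2 \<le> CARD('n)" and sol: "is_solution \<alpha> \<beta> S x y"
    and H: "\<And>t. hamiltonian \<alpha> \<beta> S (x t) (y t) = c" and c: "c < min_saddle_value U"
  shows "low_energy_orbit S \<epsilon> (\<lambda>t. x (t / a) /\<^sub>R a) (\<lambda>t. y (t / a) /\<^sub>R a\<^sup>2) (c / a ^ 4)"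
proof
  show "2 \<le> CARD('n)" by (rule n)
  show "c / a ^ 4 < pot (crit_pt \<sigma>)" if "one_zero \<sigma> i" for \<sigma> i
    using min_saddle_value_le [OF n that] c a_pos by (simp add: field_simps)
  have nth: "((\<lambda>t. f t $ i) has_real_derivative f' $ i) (at t)"
    if "(f has_vector_derivative f') (at t)" for f :: "real \<Rightarrow> real ^ 'n" and f' t i
    using bounded_linear.has_vector_derivative [OF bounded_linear_vec_nth that]
    by (simp add: has_real_derivative_iff_has_vector_derivative)
  have scale: "((\<lambda>t. t / a) has_real_derivative 1 / a) (at t)" for t
    by (rule DERIV_cdivide [OF DERIV_ident])
  have x: "((\<lambda>t. x t $ i) has_real_derivative y t $ i) (at t)" for t i
    using sol by (intro nth) (simp add: is_solution_def)
  have y: "((\<lambda>t. y t $ i) has_real_derivative - gradient \<alpha> \<beta> S (x t) i) (at t)" for t i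
  proof -
    have "(y has_vector_derivative (\<chi> i. - ((x t $ i)\<^sup>2 + \<beta> - \<alpha>\<^sup>2) * x t $ i
        + (\<Sum>j\<in>UNIV. S $ i $ j * x t $ j))) (at t)"
      using sol by (simp add: is_solution_def)
    from nth [OF this, of i] show ?thesis
      by (simp add: gradient_def matrix_vector_mult_def power2_eq_square power3_eq_cube algebra_simps)
  qed
  show "((\<lambda>t. (x (t / a) /\<^sub>R a) $ i) has_real_derivative (y (t / a) /\<^sub>R a\<^sup>2) $ i) (at t)" for t i
    using DERIV_cmult [OF DERIV_chain' [OF scale x [of i]], of "inverse a" t]
    by (simp add: power2_eq_square divide_inverse mult_ac)
  show "((\<lambda>t. (y (t / a) /\<^sub>R a\<^sup>2) $ i) has_real_derivative force (x (t / a) /\<^sub>R a) i) (at t)" for t i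
  proof -
    have "- gradient \<alpha> \<beta> S (x (t / a)) i = a ^ 3 * force (x (t / a) /\<^sub>R a) i"
      using gradient_scale [of "x (t / a) /\<^sub>R a" i] a_pos by simp
    then have "inverse (a\<^sup>2) * (- gradient \<alpha> \<beta> S (x (t / a)) i * (1 / a)) = force (x (t / a) /\<^sub>R a) i"
      using a_pos by (simp add: power2_eq_square power3_eq_cube field_simps)
    moreover have "((\<lambda>t. inverse (a\<^sup>2) * y (t / a) $ i) has_real_derivative
        inverse (a\<^sup>2) * (- gradient \<alpha> \<beta> S (x (t / a)) i * (1 / a))) (at t)"
      by (rule DERIV_cmult [OF DERIV_cong [OF DERIV_chain' [OF scale y]]]) simp
    ultimately show ?thesis by simp
  qed
  show "(\<Sum>i\<in>UNIV. ((y (t / a) /\<^sub>R a\<^sup>2) $ i)\<^sup>2 / 2) + pot (x (t / a) /\<^sub>R a) = c / a ^ 4" for t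
  proof -
    have "a ^ 4 * (\<Sum>i\<in>UNIV. ((y (t / a) /\<^sub>R a\<^sup>2) $ i)\<^sup>2 / 2) = (\<Sum>i\<in>UNIV. 1 / 2 * (y (t / a) $ i)\<^sup>2)"
      unfolding sum_distrib_left using a_pos
      by (intro sum.cong refl) (simp add: power_mult_distrib power2_eq_square power4_eq_xxxx field_simps)
    moreover have "a ^ 4 * pot (x (t / a) /\<^sub>R a) = U (x (t / a))"
      using U_scale [of "x (t / a) /\<^sub>R a"] a_pos by simp
    ultimately have "a ^ 4 * ((\<Sum>i\<in>UNIV. ((y (t / a) /\<^sub>R a\<^sup>2) $ i)\<^sup>2 / 2) + pot (x (t / a) /\<^sub>R a)) = c"
      using H [of "t / a"] by (simp add: hamiltonian_def distrib_left)
    then show ?thesis using a_pos by (simp add: field_simps)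
  qed
qed

text \<open>As \<open>S\<close> has zero diagonal, testing along axis \<open>i\<close> gives
  \<open>3 * (x $ i)^2 > a^2\<close>. This takes an arbitrary neighborhood of minimum point to the
  threshold 1/2 of \<open>no_sign_change\<close>.\<close>

lemma pos_def_hessian_component:
  assumes "pos_def (hessian U x)"
  shows "a / 2 \<le> \<bar>x $ i\<bar>"
proof (rule ccontr)
  assume "\<not> ?thesis"
  then have "\<bar>x $ i\<bar> * \<bar>x $ i\<bar> \<le> a / 2 * (a / 2)"
    using a_pos by (intro mult_mono) auto
  then have "4 * (x $ i)\<^sup>2 \<le> a\<^sup>2" by (simp add: power2_eq_square)
  moreover have "axis i 1 \<noteq> (0 :: real ^ 'n)" by (simp add: axis_eq_0_iff)
  then have "0 < axis i 1 \<bullet> (hessian U x *v axis i 1)"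
    using assms by (simp add: pos_def_def)
  then have "0 < 3 * (x $ i)\<^sup>2 - a\<^sup>2"
    by (simp add: inner_axis' matrix_vector_mul_component inner_axis hessian_potential [OF sym]
        beta_alpha diag)
  ultimately show False using zero_le_power2 [of "x $ i"] by linarith
qed

text \<open>A neighborhood carries the signs of its minimum, and these signs determine the minimum.
  Two different minima would need a coordinate that changes its well.\<close>

lemma low_energy_same_min:
  assumes n: "2 \<le> CARD('n)" and orbit: "orbit_with_energy \<alpha> \<beta> S c x" and c: "c < min_saddle_value U"
    and x1: "x1 \<in> local_min_points U" "min_nbhd U x1 N1" "x t1 \<in> N1"
    and x2: "x2 \<in> local_min_points U" "min_nbhd U x2 N2" "x t2 \<in> N2"
  shows "x1 = x2"
proof (rule ccontr)
  assume "x1 \<noteq> x2"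
  obtain y where sol: "is_solution \<alpha> \<beta> S x y" and H: "\<And>t. hamiltonian \<alpha> \<beta> S (x t) (y t) = c"
    using orbit by (auto simp: orbit_with_energy_def)
  interpret orb: low_energy_orbit S \<epsilon> "\<lambda>t. x (t / a) /\<^sub>R a" "\<lambda>t. y (t / a) /\<^sub>R a\<^sup>2" "c / a ^ 4"
    by (rule low_energy_orbit_of_solution [OF n sol H c])
  have far: "a / 2 \<le> \<bar>x t1 $ i\<bar>" "a / 2 \<le> \<bar>x t2 $ i\<bar>" for i
    using x1(2,3) x2(2,3) pos_def_hessian_component by (simp_all add: min_nbhd_def)
  have sg: "signum_vec (x t1) = signum_vec x1" "signum_vec (x t2) = signum_vec x2"
    using x1 x2 by (auto simp: min_nbhd_def)
  have "signum_vec x1 \<noteq> signum_vec x2"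
    using x1(1) x2(1) \<open>x1 \<noteq> x2\<close> by (auto simp: local_min_points_U signum_P)
  then obtain i where i: "sgn (x t1 $ i) \<noteq> sgn (x t2 $ i)"
    unfolding sg [symmetric] by (auto simp: signum_vec_def vec_eq_iff)
  have nsc: "\<not> (a / 2 \<le> x s $ i \<and> x t $ i \<le> - (a / 2))" for s t
    using orb.no_sign_change [of "a * s" i "a * t"] a_pos by (simp add: field_simps)
  show False
    using i far [of i] nsc [of t1 t2] nsc [of t2 t1] a_pos
    by (auto simp: sgn_if abs_if split: if_splits)
qed

text \<open>A shrunken orthant fits the times found by \<open>exists_all_good\<close> and is
  path-connected by convexity.\<close>

lemma min_nbhd_orthant:
  assumes \<sigma>: "\<sigma> \<in> sign_vectors"
  shows "min_nbhd U (P \<sigma>) {x. \<forall>k. a * (579 / 1000) < \<sigma> $ k * x $ k}" (is "min_nbhd U _ ?N")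
proof -
  have \<sigma>l: "\<sigma> \<in> labels" using \<sigma> sign_vectors_subset_labels by blast
  have \<sigma>k: "\<sigma> $ k = -1 \<or> \<sigma> $ k = 1" for k using \<sigma> by (auto simp: sign_vectors_def)
  have N: "?N = (\<Inter>k. {x. a * (579 / 1000) < axis k (\<sigma> $ k) \<bullet> x})"
    by (auto simp: inner_axis')
  have "open ?N"
    unfolding N by (intro open_INT ballI open_halfspace_gt) auto
  moreover have "P \<sigma> \<in> ?N"
    unfolding mem_Collect_eq
  proof
    fix k
    have "579 / 1000 < \<sigma> $ k * crit_pt \<sigma> $ k"
      using near_crit_pt [OF \<sigma>l, of k] \<sigma>k [of k] by (auto simp: abs_if split: if_splits)
    from mult_strict_left_mono [OF this a_pos]
    show "a * (579 / 1000) < \<sigma> $ k * P \<sigma> $ k" by (simp add: mult_ac)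
  qed
  moreover have "convex ?N"
    unfolding N by (intro convex_INT convex_halfspace_gt)
  moreover have "\<tau> = \<sigma>" if \<tau>: "\<tau> \<in> labels" "P \<tau> \<in> ?N" for \<tau>
  proof -
    have "\<tau> $ k = \<sigma> $ k" for k
    proof -
      have "a * (579 / 1000) < a * (\<sigma> $ k * crit_pt \<tau> $ k)"
        using \<tau>(2) by (auto simp: mult_ac)
      then have "579 / 1000 < \<sigma> $ k * crit_pt \<tau> $ k"
        using a_pos by (simp only: mult_less_cancel_left_pos)
      moreover have "\<tau> $ k \<in> {-1, 0, 1}" using \<tau>(1) by (simp add: labels_def)
      ultimately show ?thesis
        using near_crit_pt [OF \<tau>(1), of k] \<sigma>k [of k] by (auto simp: abs_if split: if_splits)
    qed
    then show ?thesis by (simp add: vec_eq_iff)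
  qed
  then have "?N \<inter> critical_points U \<subseteq> {P \<sigma>}"
    unfolding critical_points_U by blast
  moreover have "P \<sigma> \<in> critical_points U" using \<sigma>l by (rule P_critical)
  moreover have "pos_def (hessian U x)" if x: "x \<in> ?N" for x
    unfolding pos_def_def
  proof (intro allI impI)
    fix h :: "real ^ 'n" assume "h \<noteq> 0"
    have "a\<^sup>2 / 200 * (h $ k)\<^sup>2 \<le> (3 * (x $ k)\<^sup>2 + (\<beta> - \<alpha>\<^sup>2)) * (h $ k)\<^sup>2" for k
    proof (rule mult_right_mono)
      have "a * (579 / 1000) < \<sigma> $ k * x $ k" using x by simp
      then have "a * (579 / 1000) \<le> \<bar>x $ k\<bar>" using \<sigma>k [of k] by auto
      then have "a * (579 / 1000) * (a * (579 / 1000)) \<le> \<bar>x $ k\<bar> * \<bar>x $ k\<bar>"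
        using a_pos by (intro mult_mono) auto
      \<comment> \<open>3 * 0.335241 - 1 = 0.005723 leaves the margin 1/200 that absorbs the
        coupling.\<close>
      then have "a\<^sup>2 * (335241 / 1000000) \<le> (x $ k)\<^sup>2" by (simp add: power2_eq_square)
      then show "a\<^sup>2 / 200 \<le> 3 * (x $ k)\<^sup>2 + (\<beta> - \<alpha>\<^sup>2)"
        unfolding beta_alpha using zero_le_power2 [of a] by linarith
    qed simp
    then have "(\<Sum>k\<in>UNIV. a\<^sup>2 / 200 * (h $ k)\<^sup>2) \<le> (\<Sum>k\<in>UNIV. (3 * (x $ k)\<^sup>2 + (\<beta> - \<alpha>\<^sup>2)) * (h $ k)\<^sup>2)"
      by (rule sum_mono)
    moreover have "(\<Sum>k\<in>UNIV. a\<^sup>2 / 200 * (h $ k)\<^sup>2) = a\<^sup>2 * (norm h)\<^sup>2 / 200"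
      by (simp add: norm_sq_eq_sum sum_distrib_left sum_divide_distrib)
    moreover have "h \<bullet> (S *v h) \<le> a\<^sup>2 * (norm h)\<^sup>2 / 400000"
    proof -
      have "\<epsilon> * (h \<bullet> (S *v h)) \<le> (norm h)\<^sup>2 / 400000"
        using abs_quadratic_le [OF component_le_norm_cart, of h] by simp
      then have "a\<^sup>2 * (\<epsilon> * (h \<bullet> (S *v h))) \<le> a\<^sup>2 * ((norm h)\<^sup>2 / 400000)"
        by (rule mult_left_mono) simp
      then show ?thesis using a_pos by (simp add: eps_eq)
    qed
    moreover have "0 < a\<^sup>2 * (norm h)\<^sup>2" using a_pos \<open>h \<noteq> 0\<close> by simp
    ultimately show "0 < h \<bullet> (hessian U x *v h)"
      unfolding inner_hessian_potential [OF sym] by linarith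
  qed
  moreover have "signum_vec x = signum_vec (P \<sigma>)" if x: "x \<in> ?N" for x
  proof -
    have "sgn (x $ k) = \<sigma> $ k" for k
    proof -
      have "a * (579 / 1000) < \<sigma> $ k * x $ k" using x by simp
      moreover have "0 < a * (579 / 1000)" using a_pos by simp
      ultimately have "0 < \<sigma> $ k * x $ k" by linarith
      then show ?thesis using \<sigma>k [of k] by (auto simp: sgn_if)
    qed
    then show ?thesis by (simp add: signum_P [OF \<sigma>]) (simp add: signum_vec_def vec_eq_iff)
  qed
  ultimately show ?thesis
    unfolding min_nbhd_def using convex_imp_path_connected interior_open by blast
qed

text \<open>One good time suffices, because \<open>low_energy_same_min\<close> excludes every other
  minimum at all times.\<close>

lemma low_energy_capture:
  assumes n: "2 \<le> CARD('n)" and orbit: "orbit_with_energy \<alpha> \<beta> S c x" and c: "c < min_saddle_value U"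
  shows "capture U x"
proof -
  obtain y where sol: "is_solution \<alpha> \<beta> S x y" and H: "\<And>t. hamiltonian \<alpha> \<beta> S (x t) (y t) = c"
    using orbit by (auto simp: orbit_with_energy_def)
  interpret orb: low_energy_orbit S \<epsilon> "\<lambda>t. x (t / a) /\<^sub>R a" "\<lambda>t. y (t / a) /\<^sub>R a\<^sup>2" "c / a ^ 4"
    by (rule low_energy_orbit_of_solution [OF n sol H c])
  obtain r where r: "\<And>k. 579 / 1000 < \<bar>(x (r / a) /\<^sub>R a) $ k\<bar>"
    using orb.exists_all_good by blast
  define t3 where "t3 = r / a"
  define \<sigma> :: "real ^ 'n" where "\<sigma> = (\<chi> k. if 0 < x t3 $ k then 1 else -1)"
  have \<sigma>: "\<sigma> \<in> sign_vectors" by (simp add: \<sigma>_def sign_vectors_def)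
  let ?N = "{x. \<forall>k. a * (579 / 1000) < \<sigma> $ k * x $ k}"
  have N: "min_nbhd U (P \<sigma>) ?N" by (rule min_nbhd_orthant [OF \<sigma>])
  have x3: "P \<sigma> \<in> local_min_points U" using \<sigma> by (rule local_min_P)
  have big: "a * (579 / 1000) < \<bar>x t3 $ k\<bar>" for k
    using r [of k] a_pos by (simp add: t3_def abs_mult field_simps)
  have "\<sigma> $ k * x t3 $ k = \<bar>x t3 $ k\<bar>" for k
    by (simp add: \<sigma>_def)
  with big have xN: "x t3 \<in> ?N" by simp
  show ?thesis
    unfolding capture_def
  proof (intro exI bexI conjI allI ballI impI notI)
    show "min_nbhd U (P \<sigma>) ?N" "x t3 \<in> ?N" "P \<sigma> \<in> local_min_points U"
      by (fact N xN x3)+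
    fix t x4 N4
    assume "x4 \<in> local_min_points U - {P \<sigma>}" "min_nbhd U x4 N4" "x t \<in> N4"
    with low_energy_same_min [OF n orbit c x3 N xN, of x4 N4 t] show False by auto
  qed
qed

end

section \<open>Choice of the threshold\<close>

lemma ex_positive_gap:
  fixes f :: "'a \<Rightarrow> real"
  assumes "finite A"
  shows "\<exists>g>0. \<forall>v\<in>A. \<forall>w\<in>A. f w < f v \<longrightarrow> g \<le> f v - f w"
proof -
  define D where "D = (\<lambda>(v, w). f v - f w) ` {(v, w) \<in> A \<times> A. f w < f v}"
  have "finite D"
    unfolding D_def using assms by (auto intro!: finite_imageI intro: finite_subset [of _ "A \<times> A"])
  \<comment> \<open>\<open>insert 1\<close> provides a value when \<open>f\<close> is constant on
    \<open>A\<close> and \<open>D\<close> is empty.\<close>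
  then have "Min (insert 1 D) > 0" "\<forall>d\<in>D. Min (insert 1 D) \<le> d"
    by (auto simp: D_def)
  then show ?thesis
    unfolding D_def by force
qed

theorem theorem1p2:
  fixes \<beta> :: real and S :: "real ^ 'n ^ 'n"
  assumes "CARD('n) \<ge> 2"
    and "\<beta> > 0"
    and "transpose S = S"
    and "\<forall>i. S $ i $ i = 0"
  shows "\<exists>\<alpha>s>0. admissible_threshold \<beta> S \<alpha>s \<and>
    (\<forall>\<alpha>>\<alpha>s. \<forall>c :: real. \<forall>x :: real \<Rightarrow> real ^ 'n. orbit_in_hill_region \<alpha> \<beta> S c x \<longrightarrow>
       (transit (potential \<alpha> \<beta> S) x \<longrightarrow> c \<ge> min_saddle_value (potential \<alpha> \<beta> S)) \<and>
       (c < min_saddle_value (potential \<alpha> \<beta> S) \<longrightarrow> capture (potential \<alpha> \<beta> S) x))"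
proof -
  let ?L = "coupling_sum S"
  obtain g where g: "0 < g" "\<And>v w. v \<in> sign_vectors \<Longrightarrow> w \<in> sign_vectors \<Longrightarrow>
      ising_energy S w < ising_energy S v \<Longrightarrow> g \<le> ising_energy S v - ising_energy S w"
    using ex_positive_gap [OF finite_sign_vectors, of "ising_energy S"] by blast
  \<comment> \<open>\<open>M1\<close> secures \<open>small\<close> for \<epsilon> = 1 / (\<alpha>^2
    - \<beta>), and \<open>M2\<close> pushes the Ising error \<open>2 * \<epsilon> * ?L^2\<close>
    below the gap \<open>g\<close>.\<close>
  define M1 where "M1 = 100000 * (?L * (2 * CARD('n) + 2))"
  define M2 where "M2 = 2 * ?L\<^sup>2 / g"
  have M: "0 \<le> M1" "0 \<le> M2"
    using coupling_sum_ge_1 [of S] g by (auto simp: M1_def M2_def)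
  define \<alpha>s where "\<alpha>s = sqrt (\<beta> + M1 + M2)"
  have "0 < \<alpha>s" using assms(2) M by (simp add: \<alpha>s_def)
  have scaled: "scaled_potential S (1 / (\<alpha>\<^sup>2 - \<beta>)) \<alpha> \<beta> (sqrt (\<alpha>\<^sup>2 - \<beta>))"
    and gap: "2 * (1 / (\<alpha>\<^sup>2 - \<beta>)) * ?L\<^sup>2 < g" if "\<alpha> > \<alpha>s" for \<alpha>
  proof -
    have "\<alpha>s\<^sup>2 < \<alpha>\<^sup>2" using that \<open>0 < \<alpha>s\<close> by (intro power_strict_mono) auto
    then have b: "M1 + M2 < \<alpha>\<^sup>2 - \<beta>" using assms(2) M by (simp add: \<alpha>s_def)
    then have pos: "0 < \<alpha>\<^sup>2 - \<beta>" using M by linarith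
    have "1 / (\<alpha>\<^sup>2 - \<beta>) * ?L * (2 * CARD('n) + 2) \<le> 1 / 100000"
    proof -
      have "M1 \<le> \<alpha>\<^sup>2 - \<beta>" using b M by linarith
      then show ?thesis using pos unfolding M1_def by (simp add: field_simps)
    qed
    then show "scaled_potential S (1 / (\<alpha>\<^sup>2 - \<beta>)) \<alpha> \<beta> (sqrt (\<alpha>\<^sup>2 - \<beta>))"
      using assms pos by unfold_locales auto
    have "M2 < \<alpha>\<^sup>2 - \<beta>" using b M by linarith
    then show "2 * (1 / (\<alpha>\<^sup>2 - \<beta>)) * ?L\<^sup>2 < g"
      using pos g(1) unfolding M2_def by (simp add: field_simps)
  qed
  have "admissible_threshold \<beta> S \<alpha>s"
    unfolding admissible_threshold_def
  proof (intro conjI allI impI ballI)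
    fix \<alpha> assume \<alpha>: "\<alpha> > \<alpha>s"
    interpret scaled_potential S "1 / (\<alpha>\<^sup>2 - \<beta>)" \<alpha> \<beta> "sqrt (\<alpha>\<^sup>2 - \<beta>)"
      by (rule scaled [OF \<alpha>])
    show "card (critical_points (potential \<alpha> \<beta> S)) = 3 ^ CARD('n)"
      by (rule card_critical_points_U)
    show "card (local_min_points (potential \<alpha> \<beta> S)) = 2 ^ CARD('n)"
      by (rule card_local_min_points_U)
    show "signum_vec ` local_min_points (potential \<alpha> \<beta> S) = sign_vectors"
      by (rule signum_local_min_points_U)
    show "is_arg_min (ising_energy S) (\<lambda>v. v \<in> sign_vectors) (signum_vec x)"
      if "x \<in> global_min_points (potential \<alpha> \<beta> S)" for x
    proof (rule global_min_signum [OF _ that])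
      fix v w :: "real ^ 'n"
      assume "v \<in> sign_vectors" "w \<in> sign_vectors" "ising_energy S w < ising_energy S v"
      from g(2) [OF this] gap [OF \<alpha>]
      show "ising_energy S w + 2 * (1 / (\<alpha>\<^sup>2 - \<beta>)) * ?L\<^sup>2 < ising_energy S v" by linarith
    qed
  qed (rule \<open>0 < \<alpha>s\<close>)
  moreover have "(transit (potential \<alpha> \<beta> S) x \<longrightarrow> c \<ge> min_saddle_value (potential \<alpha> \<beta> S)) \<and>
       (c < min_saddle_value (potential \<alpha> \<beta> S) \<longrightarrow> capture (potential \<alpha> \<beta> S) x)"
    if \<alpha>: "\<alpha> > \<alpha>s" and "orbit_in_hill_region \<alpha> \<beta> S c x" for \<alpha> c x
  proof -
    interpret scaled_potential S "1 / (\<alpha>\<^sup>2 - \<beta>)" \<alpha> \<beta> "sqrt (\<alpha>\<^sup>2 - \<beta>)"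
      by (rule scaled [OF \<alpha>])
    have orbit: "orbit_with_energy \<alpha> \<beta> S c x"
      using that by (simp add: orbit_in_hill_region_def)
    have "\<not> transit U x" if "c < min_saddle_value U"
      using low_energy_same_min [OF assms(1) orbit that] unfolding transit_def transit_on_def by blast
    then show ?thesis
      using low_energy_capture [OF assms(1) orbit] by (meson not_less)
  qed
  ultimately show ?thesis
    using \<open>0 < \<alpha>s\<close> by blast
qed

end
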